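(* Fix a finite monoidal signature $\Sigma$. Given HARs $f$ of type $n\to m$ and $g$ of type $m\to l$ over $\Sigma$, of sizes $f_K$ and $g_K$, the composite HAR $f;g$ can be computed in time $O(f_K+g_K)$, where the implied constant depends only on $\Sigma$.
   Context: Cost model: unit-cost RAM, with all matrices stored in a sparse row-wise format (for each row, the list of its non-zero entries with their column indices) and label vectors stored as arrays. A monoidal signature $\Sigma$ is a set of operations $o:n\to m$, each with an arity $n\in\mathbb N$ and a coarity $m\in\mathbb N$. Matrix conventions. $\mathsf{Mat}_S(n,m)$ is the set of $m\times n$ matrices over the semiring $S$ ($S=\mathbb B$ or $\mathbb N$), regarded as maps $n\to m$; composition is written in diagrammatic order, so $A;B$ is the ordinary matrix product $BA$. $A\oplus B$ is the block-diagonal direct sum. Boolean permutation matrices are also used as matrices over $\mathbb N$. If $P$ is the $K\times K$ permutation matrix of a bijection $p$ (so $P_{p(j),j}=1$) and $N$ is a length-$K$ list of labels, then $N;P$ is the list with $(N;P)_{p(j)}=N_j$. A matrix $M\in\mathsf{Mat}_{\mathbb N}(K,K)$ represents a directed graph with edge labels on vertices $1,\dots,K$: there is an edge $j\to i$ exactly when $M_{ij}\neq 0$, and its label is $M_{ij}$. HARs. A HAR (hypergraph adjacency representation) $f$ of type $n\to m$ over $\Sigma$ consists of a size $f_K=K\in\mathbb N$, a matrix $f_M=M\in\mathsf{Mat}_{\mathbb N}(K,K)$, permutation matrices $f_L=L,\ f_R=R\in\mathsf{Mat}_{\mathbb B}(K,K)$, and node labels $f_N=N\in(\{\bullet\}+(\{\circ\}\times\Sigma))^K$,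 such that: the graph of $M$ is acyclic and bipartite (every edge joins a $\bullet$-vertex and a $\circ$-vertex); every $\bullet$-vertex has at most one incoming and at most one outgoing edge; calling the $\bullet$-vertices without incoming edges the left interface nodes and the $\bullet$-vertices without outgoing edges the right interface nodes, there are exactly $n$ left interface nodes and they are the first $n$ vertices in the reordered matrix $L^T;M;L$, and there are exactly $m$ right interface nodes and they are the last $m$ vertices in the reordered matrix $R^T;M;R$; and each vertex labeled $(\circ,g)$ with $g:a\to b$ in $\Sigma$ has exactly $a$ incoming edges, labeled $1,\dots,a$, and exactly $b$ outgoing edges, labeled $1,\dots,b$ (each label occurring once). Boundary orders. $L(f)$ has $L(f)_M=f_L^T;f_M;f_L$, $L(f)_L=\mathrm{id}$, $L(f)_R=f_L^T;f_R$, $L(f)_N=f_N;f_L$. $R(f)$ has $R(f)_M=f_R^T;f_M;f_R$, $R(f)_L=f_R^T;f_L$, $R(f)_R=\mathrm{id}$, $R(f)_N=f_N;f_R$. Composition of $f:n\to m$ and $g:m\to l$, of size $f_K+g_K-m$: $(f;g)_M=A\oplus B$, where $A$ is the $f_K\times(f_K-m)$ matrix of the first $f_K-m$ columns of $R(f)_M$ and $B$ is the $(g_K-m)\times g_K$ matrix of the last $g_K-m$ rows of $L(g)_M$; $(f;g)_L=R(f)_L\oplus\mathrm{id}_{g_K-m}$; $(f;g)_R=\mathrm{id}_{f_K-m}\oplus L(g)_R$; $(f;g)_N$ is $R(f)_N$ followed by $L(g)_N$ with its first $m$ entries removed. *)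

theory Defs
  imports "Jordan_Normal_Form.Matrix" "HOL-Library.Landau_Symbols" "HOL-Combinatorics.Permutations"
begin

section \<open>Monoidal signatures and matrices\<close>

record 'o signature =
  ops :: "'o set"
  arity :: "'o \<Rightarrow> nat"
  coarity :: "'o \<Rightarrow> nat"

text \<open>
  Boolean permutation matrices are represented by their 0/1-valued natural-number matrices.
  Rows, columns and vertices are counted from 0.  As matrices are maps from columns to rows,
  the diagrammatic composite is the matrix product in the opposite order.
\<close>

abbreviation mat_seq :: "nat mat \<Rightarrow> nat mat \<Rightarrow> nat mat" (infixl ";;" 65)
  where "A ;; B \<equiv> B * A"

definition direct_sum :: "nat mat \<Rightarrow> nat mat \<Rightarrow> nat mat" (infixr "\<oplus>\<^sub>d" 65)
  where "A \<oplus>\<^sub>d B = four_block_mat A (0\<^sub>m (dim_row A) (dim_col B)) (0\<^sub>m (dim_row B) (dim_col A)) B"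

definition first_cols :: "nat \<Rightarrow> nat mat \<Rightarrow> nat mat"
  where "first_cols c A = mat (dim_row A) c (\<lambda>(i, j). A $$ (i, j))"

definition last_rows :: "nat \<Rightarrow> nat mat \<Rightarrow> nat mat"
  where "last_rows r A = mat r (dim_col A) (\<lambda>(i, j). A $$ (dim_row A - r + i, j))"

definition perm_mat :: "nat \<Rightarrow> (nat \<Rightarrow> nat) \<Rightarrow> nat mat"
  where "perm_mat K p = mat K K (\<lambda>(i, j). if i = p j then 1 else 0)"

definition is_perm_mat :: "nat \<Rightarrow> nat mat \<Rightarrow> bool"
  where "is_perm_mat K P \<longleftrightarrow> (\<exists>p. p permutes {..<K} \<and> P = perm_mat K p)"

text \<open>If \<open>P = perm_mat K p\<close>, then entry \<open>p j\<close> of \<open>permute_labels N P\<close> is entry \<open>j\<close> of \<open>N\<close>;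
  see the lemma \<open>nth_permute_labels\<close> below.\<close>

definition permute_labels :: "'a list \<Rightarrow> nat mat \<Rightarrow> 'a list"
  where "permute_labels N P = map (\<lambda>i. N ! (THE j. j < length N \<and> P $$ (i, j) = 1)) [0..<length N]"


section \<open>Hypergraph adjacency representations\<close>

datatype 'o node_label = Bullet | Circ 'o

text \<open>An edge is a pair (source, target); the entry in row \<open>i\<close> and column \<open>j\<close> labels the
  edge from \<open>j\<close> to \<open>i\<close>.\<close>

definition edges :: "nat mat \<Rightarrow> (nat \<times> nat) set"
  where "edges M = {(j, i). i < dim_row M \<and> j < dim_col M \<and> M $$ (i, j) \<noteq> 0}"

definition edge_label :: "nat mat \<Rightarrow> nat \<times> nat \<Rightarrow> nat"
  where "edge_label M = (\<lambda>(j, i). M $$ (i, j))"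

definition in_edges :: "nat mat \<Rightarrow> nat \<Rightarrow> (nat \<times> nat) set"
  where "in_edges M v = {e \<in> edges M. snd e = v}"

definition out_edges :: "nat mat \<Rightarrow> nat \<Rightarrow> (nat \<times> nat) set"
  where "out_edges M v = {e \<in> edges M. fst e = v}"

definition left_interface :: "nat mat \<Rightarrow> 'o node_label list \<Rightarrow> nat set"
  where "left_interface M N = {v. v < length N \<and> N ! v = Bullet \<and> in_edges M v = {}}"

definition right_interface :: "nat mat \<Rightarrow> 'o node_label list \<Rightarrow> nat set"
  where "right_interface M N = {v. v < length N \<and> N ! v = Bullet \<and> out_edges M v = {}}"

definition labelled_hypergraph :: "'o signature \<Rightarrow> nat \<Rightarrow> nat mat \<Rightarrow> 'o node_label list \<Rightarrow> bool"
  where "labelled_hypergraph \<Sigma> K M N \<longleftrightarrow>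
    M \<in> carrier_mat K K \<and>
    length N = K \<and>
    set N \<subseteq> insert Bullet (Circ ` ops \<Sigma>) \<and>
    acyclic (edges M) \<and>
    (\<forall>(j, i) \<in> edges M. (N ! j = Bullet) \<noteq> (N ! i = Bullet)) \<and>
    (\<forall>v < K. N ! v = Bullet \<longrightarrow> card (in_edges M v) \<le> 1 \<and> card (out_edges M v) \<le> 1) \<and>
    (\<forall>v < K. \<forall>g. N ! v = Circ g \<longrightarrow>
       bij_betw (edge_label M) (in_edges M v) {1..arity \<Sigma> g} \<and>
       bij_betw (edge_label M) (out_edges M v) {1..coarity \<Sigma> g})"

record 'o har =
  har_K :: nat
  har_M :: "nat mat"
  har_L :: "nat mat"
  har_R :: "nat mat"
  har_N :: "'o node_label list"

definition left_order :: "'o har \<Rightarrow> 'o har"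
  where "left_order f = \<lparr>
    har_K = har_K f,
    har_M = transpose_mat (har_L f) ;; har_M f ;; har_L f,
    har_L = 1\<^sub>m (har_K f),
    har_R = transpose_mat (har_L f) ;; har_R f,
    har_N = permute_labels (har_N f) (har_L f)\<rparr>"

definition right_order :: "'o har \<Rightarrow> 'o har"
  where "right_order f = \<lparr>
    har_K = har_K f,
    har_M = transpose_mat (har_R f) ;; har_M f ;; har_R f,
    har_L = transpose_mat (har_R f) ;; har_L f,
    har_R = 1\<^sub>m (har_K f),
    har_N = permute_labels (har_N f) (har_R f)\<rparr>"

definition is_har :: "'o signature \<Rightarrow> nat \<Rightarrow> nat \<Rightarrow> 'o har \<Rightarrow> bool"
  where "is_har \<Sigma> n m f \<longleftrightarrow>
    labelled_hypergraph \<Sigma> (har_K f) (har_M f) (har_N f) \<and>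
    is_perm_mat (har_K f) (har_L f) \<and>
    is_perm_mat (har_K f) (har_R f) \<and>
    card (left_interface (har_M f) (har_N f)) = n \<and>
    left_interface (har_M (left_order f)) (har_N (left_order f)) = {..<n} \<and>
    card (right_interface (har_M f) (har_N f)) = m \<and>
    right_interface (har_M (right_order f)) (har_N (right_order f)) = {har_K f - m..<har_K f}"

definition har_comp :: "nat \<Rightarrow> 'o har \<Rightarrow> 'o har \<Rightarrow> 'o har"
  where "har_comp m f g = \<lparr>
    har_K = har_K f + har_K g - m,
    har_M = first_cols (har_K f - m) (har_M (right_order f))
              \<oplus>\<^sub>d last_rows (har_K g - m) (har_M (left_order g)),
    har_L = har_L (right_order f) \<oplus>\<^sub>d 1\<^sub>m (har_K g - m),
    har_R = 1\<^sub>m (har_K f - m) \<oplus>\<^sub>d har_R (left_order g),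
    har_N = har_N (right_order f) @ drop m (har_N (left_order g))\<rparr>"


section \<open>Unit-cost RAM\<close>

text \<open>
  A program works on registers and on a memory, both holding natural numbers.  Every instruction
  costs one step; subtraction is truncated.  The machine has halted once the program counter
  points outside the program.
\<close>

datatype instr =
    Const nat nat       (* Const d c: register d := c *)
  | Add nat nat nat     (* Add d a b: register d := register a + register b *)
  | Sub nat nat nat     (* Sub d a b: register d := register a - register b *)
  | Load nat nat        (* Load d a: register d := memory cell addressed by register a *)
  | Store nat nat       (* Store a b: memory cell addressed by register a := register b *)
  | Jump_Zero nat nat   (* Jump_Zero a q: continue at q if register a is zero *)

record ram =
  pc :: nat
  reg :: "nat \<Rightarrow> nat"
  mem :: "nat \<Rightarrow> nat"

fun exec :: "instr \<Rightarrow> ram \<Rightarrow> ram" where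
  "exec (Const d c) s = s\<lparr>pc := Suc (pc s), reg := (reg s)(d := c)\<rparr>"
| "exec (Add d a b) s = s\<lparr>pc := Suc (pc s), reg := (reg s)(d := reg s a + reg s b)\<rparr>"
| "exec (Sub d a b) s = s\<lparr>pc := Suc (pc s), reg := (reg s)(d := reg s a - reg s b)\<rparr>"
| "exec (Load d a) s = s\<lparr>pc := Suc (pc s), reg := (reg s)(d := mem s (reg s a))\<rparr>"
| "exec (Store a b) s = s\<lparr>pc := Suc (pc s), mem := (mem s)(reg s a := reg s b)\<rparr>"
| "exec (Jump_Zero a q) s = s\<lparr>pc := (if reg s a = 0 then q else Suc (pc s))\<rparr>"

definition halted :: "instr list \<Rightarrow> ram \<Rightarrow> bool"
  where "halted prog s \<longleftrightarrow> length prog \<le> pc s"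

definition step :: "instr list \<Rightarrow> ram \<Rightarrow> ram"
  where "step prog s = (if halted prog s then s else exec (prog ! pc s) s)"

definition halts_within :: "instr list \<Rightarrow> nat \<Rightarrow> ram \<Rightarrow> ram \<Rightarrow> bool"
  where "halts_within prog t s s' \<longleftrightarrow> (\<exists>k \<le> t. (step prog ^^ k) s = s' \<and> halted prog s')"


section \<open>Storage of HARs in RAM memory\<close>

text \<open>
  Sparse row-wise format: for row \<open>i\<close> of the matrix stored at address \<open>a\<close>, cell \<open>a + 2 * i\<close>
  holds the number of non-zero entries of that row and cell \<open>a + 2 * i + 1\<close> the address of the
  list of these entries, each given as a column index followed by a value.  The entries of a row
  come without repetition and in any order.  All cells used lie below address \<open>free\<close>.
\<close>

definition row_entries :: "(nat \<Rightarrow> nat) \<Rightarrow> nat \<Rightarrow> nat \<Rightarrow> (nat \<times> nat) list"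
  where "row_entries h q d = map (\<lambda>k. (h (q + 2 * k), h (q + 2 * k + 1))) [0..<d]"

definition mat_at :: "(nat \<Rightarrow> nat) \<Rightarrow> nat \<Rightarrow> nat \<Rightarrow> nat mat \<Rightarrow> bool"
  where "mat_at h free a A \<longleftrightarrow>
    a + 2 * dim_row A \<le> free \<and>
    (\<forall>i < dim_row A.
       let d = h (a + 2 * i); q = h (a + 2 * i + 1); es = row_entries h q d in
       q + 2 * d \<le> free \<and> distinct es \<and>
       set es = {(j, A $$ (i, j)) | j. j < dim_col A \<and> A $$ (i, j) \<noteq> 0})"

text \<open>\<open>code\<close> is the numbering of the operations of the signature used in label arrays.\<close>

fun label_code :: "('o \<Rightarrow> nat) \<Rightarrow> 'o node_label \<Rightarrow> nat" where
  "label_code code Bullet = 0"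
| "label_code code (Circ g) = Suc (code g)"

definition labels_at :: "('o \<Rightarrow> nat) \<Rightarrow> (nat \<Rightarrow> nat) \<Rightarrow> nat \<Rightarrow> nat \<Rightarrow> 'o node_label list \<Rightarrow> bool"
  where "labels_at code h free a N \<longleftrightarrow>
    a + length N \<le> free \<and> (\<forall>i < length N. h (a + i) = label_code code (N ! i))"

text \<open>A HAR of type \<open>n \<rightarrow> m\<close> is stored as a block of seven cells containing its type, its size and
  the addresses of its components.\<close>

definition har_at ::
    "('o \<Rightarrow> nat) \<Rightarrow> (nat \<Rightarrow> nat) \<Rightarrow> nat \<Rightarrow> nat \<Rightarrow> nat \<Rightarrow> nat \<Rightarrow> 'o har \<Rightarrow> bool"
  where "har_at code h free a n m f \<longleftrightarrow>
    a + 7 \<le> free \<and>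
    h a = n \<and> h (a + 1) = m \<and> h (a + 2) = har_K f \<and>
    mat_at h free (h (a + 3)) (har_M f) \<and>
    mat_at h free (h (a + 4)) (har_L f) \<and>
    mat_at h free (h (a + 5)) (har_R f) \<and>
    labels_at code h free (h (a + 6)) (har_N f)"


section \<open>Composites of HARs are HARs\<close>

subsection \<open>Reorderings\<close>

lemma perm_lt: "p permutes {..<K} \<Longrightarrow> (p j < K) = (j < K)" for p :: "nat \<Rightarrow> nat"
  using permutes_in_image[of p "{..<K}" j] by simp

lemma perm_mat_carrier [simp]: "perm_mat K p \<in> carrier_mat K K"
  "dim_row (perm_mat K p) = K" "dim_col (perm_mat K p) = K"
  by (simp_all add: perm_mat_def)

lemma nth_permute_labels:
  assumes p: "p permutes {..<length N}" and j: "j < length N"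
  shows "permute_labels N (perm_mat (length N) p) ! p j = N ! j"
proof -
  have pj: "p j < length N" using j perm_lt[OF p] by simp
  have "(THE j'. j' < length N \<and> perm_mat (length N) p $$ (p j, j') = 1) = j"
  proof (rule the_equality)
    show "j < length N \<and> perm_mat (length N) p $$ (p j, j) = 1"
      using j pj by (simp add: perm_mat_def)
  next
    fix j' assume "j' < length N \<and> perm_mat (length N) p $$ (p j, j') = 1"
    then have "p j = p j'" using pj by (auto simp: perm_mat_def split: if_splits)
    then show "j' = j" using permutes_inj[OF p] by (simp add: inj_eq)
  qed
  then show ?thesis using pj by (simp add: permute_labels_def)
qed

lemma reorder_mat:
  assumes p: "p permutes {..<K}" and M: "M \<in> carrier_mat K K" and i: "i < K" and j: "j < K"
  shows "(transpose_mat (perm_mat K p) ;; M ;; perm_mat K p) $$ (p i, p j) = M $$ (i, j)"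
proof -
  have pi: "p i < K" and pj: "p j < K" using i j perm_lt[OF p] by auto
  have inj: "\<And>x y. p x = p y \<longleftrightarrow> x = y" using permutes_inj[OF p] by (simp add: inj_eq)
  have a: "(M * transpose_mat (perm_mat K p)) $$ (k, p j) = M $$ (k, j)" if "k < K" for k
  proof -
    have "(M * transpose_mat (perm_mat K p)) $$ (k, p j)
        = (\<Sum>x = 0..<K. M $$ (k, x) * (if p j = p x then 1 else 0))"
      using M that pj by (simp add: scalar_prod_def perm_mat_def)
    also have "\<dots> = (\<Sum>x = 0..<K. if x = j then M $$ (k, j) else 0)"
      by (rule sum.cong) (auto simp: inj)
    finally show ?thesis using j by simp
  qed
  have "(transpose_mat (perm_mat K p) ;; M ;; perm_mat K p) $$ (p i, p j)
      = (\<Sum>x = 0..<K. (if p i = p x then 1 else 0) * (M * transpose_mat (perm_mat K p)) $$ (x, p j))"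
    using M pi pj by (simp add: scalar_prod_def perm_mat_def)
  also have "\<dots> = (\<Sum>x = 0..<K. if x = i then M $$ (i, j) else 0)"
    by (rule sum.cong) (auto simp: inj a simp del: index_mult_mat)
  finally show ?thesis using i by simp
qed

lemma perm_mat_comp:
  assumes p: "p permutes {..<K}" and q: "q permutes {..<K}"
  shows "transpose_mat (perm_mat K p) ;; perm_mat K q = perm_mat K (q \<circ> inv_into UNIV p)"
proof (rule eq_matI)
  fix i j assume "i < dim_row (perm_mat K (q \<circ> inv_into UNIV p))" "j < dim_col (perm_mat K (q \<circ> inv_into UNIV p))"
  then have i: "i < K" and j: "j < K" by auto
  have ij: "inv_into UNIV p j < K" using perm_lt[OF permutes_inv[OF p]] j by simp
  have "(transpose_mat (perm_mat K p) ;; perm_mat K q) $$ (i, j)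
      = (\<Sum>x = 0..<K. (if i = q x then 1 else 0) * (if j = p x then 1 else 0))"
    using i j by (simp add: scalar_prod_def perm_mat_def)
  also have "\<dots> = (\<Sum>x = 0..<K. if x = inv_into UNIV p j then (if i = q x then 1 else 0) else 0)"
    by (rule sum.cong) (auto simp: permutes_inverses[OF p])
  also have "\<dots> = perm_mat K (q \<circ> inv_into UNIV p) $$ (i, j)"
    using i j ij by (simp add: perm_mat_def)
  finally show "(transpose_mat (perm_mat K p) ;; perm_mat K q) $$ (i, j)
      = perm_mat K (q \<circ> inv_into UNIV p) $$ (i, j)" .
qed auto

lemma acyclic_hom:
  assumes h: "\<And>x y. (x, y) \<in> r \<Longrightarrow> (h x, h y) \<in> s" and s: "acyclic s"
  shows "acyclic r"
proof -
  have "(h x, h y) \<in> s\<^sup>+" if "(x, y) \<in> r\<^sup>+" for x y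
    using that
  proof induction
    case (base y)
    then show ?case by (intro r_into_trancl h)
  next
    case (step y z)
    then show ?case by (meson h trancl_into_trancl)
  qed
  then show ?thesis using s by (auto simp: acyclic_def)
qed

lemma acyclic_sequential:
  assumes r: "acyclic r" and s: "acyclic s" and sr: "s O r = {}"
  shows "acyclic (r \<union> s)"
proof -
  have "(x, y) \<in> r\<^sup>+ \<or> (x, y) \<in> s\<^sup>+ \<or> (x \<in> Domain r \<and> y \<in> Range s)"
    if "(x, y) \<in> (r \<union> s)\<^sup>+" for x y
    using that
  proof (induction rule: trancl_induct)
    case (step y z)
    have "y \<in> Range s" if "(x, y) \<in> s\<^sup>+" using that by (metis Range.intros trancl_range)
    moreover have "x \<in> Domain r" if "(x, y) \<in> r\<^sup>+" using that by (metis Domain.intros trancl_domain)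
    moreover have "y \<notin> Range s" if "(y, z) \<in> r" using that sr by blast
    ultimately show ?case using step by (meson RangeI UnE trancl.trancl_into_trancl)
  qed blast
  then show ?thesis using r s sr unfolding acyclic_def by blast
qed

lemma filter_union_image:
  assumes "\<And>e. e \<in> X \<Longrightarrow> \<not> P e" and "\<And>e. P (h e) \<longleftrightarrow> Q e"
  shows "{e \<in> X \<union> h ` Y. P e} = h ` {e \<in> Y. Q e}"
  using assms by auto

lemma bij_betw_relabel:
  assumes "bij_betw l S X" "inj_on h S" "\<And>e. e \<in> S \<Longrightarrow> l' (h e) = l e"
  shows "bij_betw l' (h ` S) X"
proof -
  have "bij_betw (l' \<circ> h) S X"
    using assms(1,3) bij_betw_cong[of S l "l' \<circ> h"] by simp
  then show ?thesis using bij_betw_comp_iff[OF inj_on_imp_bij_betw[OF assms(2)]] by blast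
qed

text \<open>\<open>(M', N')\<close> is \<open>(M, N)\<close> with vertex \<open>v\<close> renamed to \<open>p v\<close>.\<close>

definition reordered ::
    "nat \<Rightarrow> (nat \<Rightarrow> nat) \<Rightarrow> nat mat \<Rightarrow> 'a list \<Rightarrow> nat mat \<Rightarrow> 'a list \<Rightarrow> bool"
  where "reordered K p M N M' N' \<longleftrightarrow> p permutes {..<K} \<and>
    M \<in> carrier_mat K K \<and> M' \<in> carrier_mat K K \<and> length N = K \<and> length N' = K \<and>
    (\<forall>i<K. \<forall>j<K. M' $$ (p i, p j) = M $$ (i, j)) \<and> (\<forall>j<K. N' ! p j = N ! j)"

lemma reorderedI:
  assumes "p permutes {..<K}" "M \<in> carrier_mat K K" "length N = K"
  shows "reordered K p M N (transpose_mat (perm_mat K p) ;; M ;; perm_mat K p)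
           (permute_labels N (perm_mat K p))"
proof -
  have "transpose_mat (perm_mat K p) ;; M ;; perm_mat K p \<in> carrier_mat K K"
    by (rule carrier_matI) simp_all
  then show ?thesis
    unfolding reordered_def
  proof (intro conjI allI impI)
    fix i j assume "i < K" "j < K"
    then show "(transpose_mat (perm_mat K p) ;; M ;; perm_mat K p) $$ (p i, p j) = M $$ (i, j)"
      using reorder_mat[OF assms(1,2)] by blast
  next
    fix j assume "j < K"
    then show "permute_labels N (perm_mat K p) ! p j = N ! j"
      using nth_permute_labels[of p N j, unfolded assms(3)] assms(1) by metis
  next
    show "length (permute_labels N (perm_mat K p)) = K"
      by (simp add: permute_labels_def assms(3))
  qed (assumption | rule assms)+
qed

lemma edges_carrier: "M \<in> carrier_mat K K \<Longrightarrow> edges M \<subseteq> {..<K} \<times> {..<K}"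
  by (auto simp: edges_def)

lemma finite_edges: "finite (edges M)"
  by (rule finite_subset[of _ "{..<dim_col M} \<times> {..<dim_row M}"]) (auto simp: edges_def)

context
  fixes K p M M' and N N' :: "'o node_label list"
  assumes re: "reordered K p M N M' N'"
begin

lemma re_p: "p permutes {..<K}" using re by (simp add: reordered_def)

lemma re_inj: "inj p" using re_p by (rule permutes_inj)

lemma re_edges: "edges M' = map_prod p p ` edges M"
proof -
  have "(j, i) \<in> edges M' \<longleftrightarrow> (j, i) \<in> map_prod p p ` edges M" for i j
  proof -
    obtain i' j' where ij: "i = p i'" "j = p j'" using permutes_surj[OF re_p] by (metis surjD)
    have "(j, i) \<in> map_prod p p ` edges M \<longleftrightarrow> (j', i') \<in> edges M"
    proof
      assume "(j, i) \<in> map_prod p p ` edges M"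
      then obtain a b where "(a, b) \<in> edges M" "p j' = p a" "p i' = p b" unfolding ij by auto
      then show "(j', i') \<in> edges M" using inj_eq[OF re_inj] by metis
    next
      assume "(j', i') \<in> edges M"
      then show "(j, i) \<in> map_prod p p ` edges M"
        unfolding ij by (metis (no_types) imageI map_prod_simp)
    qed
    then show ?thesis using re perm_lt[OF re_p] unfolding ij by (auto simp: edges_def reordered_def)
  qed
  then show ?thesis by (metis (no_types, opaque_lifting) subrelI subset_antisym)
qed

lemma re_in: "in_edges M' (p v) = map_prod p p ` in_edges M v"
  by (auto simp: in_edges_def re_edges inj_eq[OF re_inj])

lemma re_out: "out_edges M' (p v) = map_prod p p ` out_edges M v"
  by (auto simp: out_edges_def re_edges inj_eq[OF re_inj])

lemma re_label: "e \<in> edges M \<Longrightarrow> edge_label M' (map_prod p p e) = edge_label M e"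
  using re by (auto simp: edges_def edge_label_def reordered_def)

lemma re_inj_on: "inj_on (map_prod p p) A"
  using re_inj by (metis inj_on_subset prod.inj_map subset_UNIV)

lemma re_vertex: "v < K \<Longrightarrow> \<exists>w<K. v = p w"
  using permutes_image[OF re_p] by (metis imageE lessThan_iff)

lemma re_left: "left_interface M' N' = p ` left_interface M N"
  using re perm_lt[OF re_p] re_vertex
  by (force simp: left_interface_def reordered_def re_in)

lemma re_right: "right_interface M' N' = p ` right_interface M N"
  using re perm_lt[OF re_p] re_vertex
  by (force simp: right_interface_def reordered_def re_out)


lemma re_hypergraph:
  assumes "labelled_hypergraph \<Sigma> K M N"
  shows "labelled_hypergraph \<Sigma> K M' N'"
proof -
  have N': "N' ! p v = N ! v" if "v < K" for v using re that by (simp add: reordered_def)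
  have "set N' \<subseteq> set N"
    using re re_vertex by (fastforce simp: reordered_def in_set_conv_nth)
  moreover have "acyclic (edges M')"
  proof (rule acyclic_hom[where h = "inv_into UNIV p" and s = "edges M"])
    fix x y assume "(x, y) \<in> edges M'"
    then show "(inv_into UNIV p x, inv_into UNIV p y) \<in> edges M"
      by (auto simp: re_edges inv_f_f[OF re_inj])
  qed (use assms in \<open>simp add: labelled_hypergraph_def\<close>)
  moreover have "(N' ! j = Bullet) \<noteq> (N' ! i = Bullet)" if e: "(j, i) \<in> edges M'" for j i
  proof -
    obtain j' i' where *: "(j', i') \<in> edges M" "j = p j'" "i = p i'"
      using e by (auto simp: re_edges)
    then have "j' < K" "i' < K" using re edges_carrier[of M K] by (auto simp: reordered_def)
    then show ?thesis using * assms N' by (fastforce simp: labelled_hypergraph_def)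
  qed
  moreover have "card (in_edges M' v) \<le> 1 \<and> card (out_edges M' v) \<le> 1"
    if v: "v < K" "N' ! v = Bullet" for v
  proof -
    obtain w where "w < K" "v = p w" using re_vertex v by blast
    then show ?thesis
      using v N' assms by (auto simp: labelled_hypergraph_def re_in re_out card_image[OF re_inj_on])
  qed
  moreover have "bij_betw (edge_label M') (in_edges M' v) {1..arity \<Sigma> g} \<and>
      bij_betw (edge_label M') (out_edges M' v) {1..coarity \<Sigma> g}"
    if v: "v < K" "N' ! v = Circ g" for v g
  proof -
    obtain w where w: "w < K" "v = p w" using re_vertex v by blast
    then have "bij_betw (edge_label M) (in_edges M w) {1..arity \<Sigma> g}"
      "bij_betw (edge_label M) (out_edges M w) {1..coarity \<Sigma> g}"
      using v N' assms by (auto simp: labelled_hypergraph_def)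
    then show ?thesis unfolding w re_in re_out
      by (intro conjI bij_betw_relabel[where l = "edge_label M"] re_inj_on)
        (auto intro!: re_label simp: in_edges_def out_edges_def)
  qed
  ultimately show ?thesis
    using re assms by (auto simp: labelled_hypergraph_def reordered_def)
qed

end

subsection \<open>Gluing\<close>

context
  fixes K K' m and A B and NA NB :: "'o node_label list" and \<Sigma>
  assumes A: "labelled_hypergraph \<Sigma> K A NA" and B: "labelled_hypergraph \<Sigma> K' B NB"
    and RA: "right_interface A NA = {K - m..<K}" and LB: "left_interface B NB = {..<m}"
    and mK: "m \<le> K"
begin

definition glue_mat where "glue_mat = first_cols (K - m) A \<oplus>\<^sub>d last_rows (K' - m) B"
definition glue_labels where "glue_labels = NA @ drop m NB"
abbreviation shifted where "shifted \<equiv> (\<lambda>x. x + (K - m))"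

lemma glue_carr: "A \<in> carrier_mat K K" "B \<in> carrier_mat K' K'" "length NA = K" "length NB = K'"
  using A B by (simp_all add: labelled_hypergraph_def)

lemma glue_mK': "m \<le> K'"
proof -
  have "left_interface B NB \<subseteq> {..<K'}" using glue_carr(4) by (auto simp: left_interface_def)
  then show ?thesis unfolding LB by simp
qed

lemma glue_dims: "dim_row A = K" "dim_col A = K" "dim_row B = K'" "dim_col B = K'"
  using glue_carr(1,2) by simp_all

lemma glue_size_eq: "K + (K' - m) = K + K' - m" "K - m + K' = K + K' - m" "K' - (K' - m) = m"
  using mK glue_mK' by simp_all

lemma glue_carrier: "glue_mat \<in> carrier_mat (K + K' - m) (K + K' - m)"
  by (rule carrier_matI)
    (simp_all add: glue_mat_def direct_sum_def first_cols_def last_rows_def glue_dims glue_size_eq)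

lemma glue_index:
  assumes i: "i < K + K' - m" and j: "j < K + K' - m"
  shows "glue_mat $$ (i, j) = (if j < K - m then if i < K then A $$ (i, j) else 0
     else if i < K then 0 else B $$ (i - (K - m), j - (K - m)))"
proof -
  have *: "\<not> i < K \<Longrightarrow> m + (i - K) = i - (K - m)" using mK by arith
  have i': "\<not> i < K \<Longrightarrow> i - K < K' - m" using i glue_mK' by arith
  have j': "\<not> j < K - m \<Longrightarrow> j - (K - m) < K'" using j mK by arith
  have ij: "i < K + (K' - m)" "j < K - m + K'" using i j by (simp_all add: glue_size_eq)
  show ?thesis
    using ij i' j' *
    by (simp add: glue_mat_def direct_sum_def first_cols_def last_rows_def glue_dims glue_size_eq(3))
qed

lemma glue_src_A: "(j, i) \<in> edges A \<Longrightarrow> j < K - m \<and> i < K"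
proof -
  assume e: "(j, i) \<in> edges A"
  then have "j < K" "i < K" using glue_carr edges_carrier by blast+
  moreover have "j \<notin> right_interface A NA" using e by (auto simp: right_interface_def out_edges_def)
  ultimately show ?thesis using RA by auto
qed

lemma glue_tgt_B: "(j, i) \<in> edges B \<Longrightarrow> j < K' \<and> m \<le> i \<and> i < K'"
proof -
  assume e: "(j, i) \<in> edges B"
  then have "j < K'" "i < K'" using glue_carr edges_carrier by blast+
  moreover have "i \<notin> left_interface B NB" using e by (auto simp: left_interface_def in_edges_def)
  ultimately show ?thesis using LB by auto
qed

lemma glue_edges: "edges glue_mat = edges A \<union> map_prod shifted shifted ` edges B"
proof (intro equalityI subsetI)
  fix e assume e: "e \<in> edges glue_mat"
  obtain j i where ji: "e = (j, i)" by (cases e)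
  have b: "i < K + K' - m" "j < K + K' - m" and nz: "glue_mat $$ (i, j) \<noteq> 0"
    using e glue_carrier ji by (auto simp: edges_def)
  show "e \<in> edges A \<union> map_prod shifted shifted ` edges B"
  proof (cases "j < K - m")
    case True
    then have "i < K" "A $$ (i, j) \<noteq> 0" using nz glue_index[OF b] by (auto split: if_splits)
    then have "e \<in> edges A" using True by (simp add: edges_def ji glue_dims)
    then show ?thesis by blast
  next
    case False
    then have i: "K \<le> i" and n: "B $$ (i - (K - m), j - (K - m)) \<noteq> 0"
      using nz glue_index[OF b] by (auto split: if_splits)
    have "i - (K - m) < K'" "j - (K - m) < K'" using i b mK False by arith+
    then have "(j - (K - m), i - (K - m)) \<in> edges B"
      using n by (simp add: edges_def glue_dims)
    moreover have "e = map_prod shifted shifted (j - (K - m), i - (K - m))"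
      using ji False i by simp
    ultimately show ?thesis by blast
  qed
next
  fix e assume "e \<in> edges A \<union> map_prod shifted shifted ` edges B"
  then show "e \<in> edges glue_mat"
  proof
    assume e: "e \<in> edges A"
    obtain j i where ji: "e = (j, i)" by (cases e)
    have b: "j < K - m" "i < K" using glue_src_A[of j i] e ji by auto
    then have b': "i < K + K' - m" "j < K + K' - m" using glue_mK' by auto
    have "glue_mat $$ (i, j) = A $$ (i, j)" using glue_index[OF b'] b by simp
    then show ?thesis using e ji b' glue_carrier by (simp add: edges_def)
  next
    assume "e \<in> map_prod shifted shifted ` edges B"
    then obtain j i where ji: "e = (shifted j, shifted i)" "(j, i) \<in> edges B" by auto
    have b: "j < K'" "m \<le> i" "i < K'" using glue_tgt_B[OF ji(2)] by auto
    have b': "shifted i < K + K' - m" "shifted j < K + K' - m" "\<not> shifted i < K" "\<not> shifted j < K - m"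
      using b mK by auto
    have "glue_mat $$ (shifted i, shifted j) = B $$ (i, j)" using glue_index[OF b'(1,2)] b'(3,4) by simp
    then show ?thesis using ji b' glue_carrier by (simp add: edges_def)
  qed
qed

lemma glue_label_A: "e \<in> edges A \<Longrightarrow> edge_label glue_mat e = edge_label A e"
proof -
  assume e: "e \<in> edges A"
  obtain j i where ji: "e = (j, i)" by (cases e)
  have b: "j < K - m" "i < K" using glue_src_A[of j i] e ji by auto
  then have b': "i < K + K' - m" "j < K + K' - m" using glue_mK' by auto
  show ?thesis using glue_index[OF b'] b ji by (simp add: edge_label_def)
qed

lemma glue_label_B: "e \<in> edges B \<Longrightarrow> edge_label glue_mat (map_prod shifted shifted e) = edge_label B e"
proof -
  assume e: "e \<in> edges B"
  obtain j i where ji: "e = (j, i)" by (cases e)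
  have b: "j < K'" "m \<le> i" "i < K'" using glue_tgt_B[of j i] e ji by auto
  have b': "shifted i < K + K' - m" "shifted j < K + K' - m" "\<not> shifted i < K" "\<not> shifted j < K - m"
    using b mK by auto
  show ?thesis using glue_index[OF b'(1,2)] b'(3,4) ji by (simp add: edge_label_def)
qed

lemma glue_in_A: "v < K \<Longrightarrow> in_edges glue_mat v = in_edges A v"
proof -
  assume v: "v < K"
  have "snd e \<noteq> v" if e: "e \<in> map_prod shifted shifted ` edges B" for e
  proof -
    obtain j i where "(j, i) \<in> edges B" "snd e = shifted i" using e by auto
    then show ?thesis using glue_tgt_B[of j i] mK v by linarith
  qed
  then show ?thesis unfolding in_edges_def glue_edges by blast
qed

lemma glue_in_B: "m \<le> v \<Longrightarrow> in_edges glue_mat (shifted v) = map_prod shifted shifted ` in_edges B v"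
proof -
  assume v: "m \<le> v"
  have "snd e \<noteq> shifted v" if "e \<in> edges A" for e
    proof -
    have "snd e < K" using glue_src_A[of "fst e" "snd e"] that by simp
    then show ?thesis using mK v by arith
  qed
  moreover have "snd (map_prod shifted shifted e) = shifted v \<longleftrightarrow> snd e = v" for e by simp
  ultimately show ?thesis unfolding in_edges_def glue_edges by (rule filter_union_image)
qed

lemma glue_out_A: "v < K - m \<Longrightarrow> out_edges glue_mat v = out_edges A v"
proof -
  assume v: "v < K - m"
  have "fst e \<noteq> v" if e: "e \<in> map_prod shifted shifted ` edges B" for e
    using e v by auto
  then show ?thesis unfolding out_edges_def glue_edges by blast
qed

lemma glue_out_B: "out_edges glue_mat (shifted v) = map_prod shifted shifted ` out_edges B v"
proof -
  have "fst e \<noteq> shifted v" if "e \<in> edges A" for e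
    using glue_src_A[of "fst e" "snd e"] that by simp
  moreover have "fst (map_prod shifted shifted e) = shifted v \<longleftrightarrow> fst e = v" for e by simp
  ultimately show ?thesis unfolding out_edges_def glue_edges by (rule filter_union_image)
qed

lemma shifted_inj: "inj_on (map_prod shifted shifted) S"
  by (auto simp: inj_on_def)

lemma glue_labels_A: "v < K \<Longrightarrow> glue_labels ! v = NA ! v"
  using glue_carr by (simp add: glue_labels_def nth_append)

lemma glue_labels_B: "v < K' \<Longrightarrow> glue_labels ! shifted v = NB ! v"
proof (cases "v < m")
  case True
  then have "v \<in> left_interface B NB" "shifted v \<in> right_interface A NA" using LB RA mK by auto
  then show ?thesis using glue_carr glue_labels_A by (auto simp: left_interface_def right_interface_def)
next
  case False
  moreover assume "v < K'"
  ultimately show ?thesis using glue_carr mK by (auto simp: glue_labels_def nth_append intro!: arg_cong[of _ _ "(!) NB"])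
qed

lemma glue_labels_length: "length glue_labels = K + K' - m"
  using glue_carr glue_mK' by (simp add: glue_labels_def)

lemma glue_in_cases: "v < K + K' - m \<Longrightarrow> v < K \<or> (\<exists>w. v = shifted w \<and> m \<le> w \<and> w < K')"
  using mK by (auto intro!: exI[of _ "v - (K - m)"])

lemma glue_out_cases: "v < K + K' - m \<Longrightarrow> v < K - m \<or> (\<exists>w. v = shifted w \<and> w < K')"
  using mK by (auto intro!: exI[of _ "v - (K - m)"])

lemma glue_left: "left_interface glue_mat glue_labels = left_interface A NA"
proof (intro equalityI subsetI)
  fix v assume v: "v \<in> left_interface glue_mat glue_labels"
  then have v': "v < K + K' - m" "glue_labels ! v = Bullet" "in_edges glue_mat v = {}"
    by (simp_all add: left_interface_def glue_labels_length)
  from glue_in_cases[OF v'(1)] show "v \<in> left_interface A NA"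
  proof
    assume "v < K"
    then show ?thesis using v' glue_carr(3) by (simp add: left_interface_def glue_in_A glue_labels_A)
  next
    assume "\<exists>w. v = shifted w \<and> m \<le> w \<and> w < K'"
    then obtain w where w: "v = shifted w" "m \<le> w" "w < K'" by blast
    have "NB ! w = Bullet" using v'(2) glue_labels_B[OF w(3)] w(1) by simp
    moreover have "in_edges B w = {}" using v'(3) unfolding w(1) glue_in_B[OF w(2)] by simp
    ultimately have "w \<in> left_interface B NB" using w(3) glue_carr(4) by (simp add: left_interface_def)
    then show ?thesis using LB w(2) by simp
  qed
next
  fix v assume "v \<in> left_interface A NA"
  then have v: "v < K" "NA ! v = Bullet" "in_edges A v = {}"
    using glue_carr(3) by (simp_all add: left_interface_def)
  moreover have "v < K + K' - m" using v(1) glue_mK' by arith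
  ultimately show "v \<in> left_interface glue_mat glue_labels"
    by (simp add: left_interface_def glue_labels_length glue_in_A glue_labels_A)
qed

lemma glue_right: "right_interface glue_mat glue_labels = shifted ` right_interface B NB"
proof (intro equalityI subsetI)
  fix v assume v: "v \<in> right_interface glue_mat glue_labels"
  then have v': "v < K + K' - m" "glue_labels ! v = Bullet" "out_edges glue_mat v = {}"
    by (simp_all add: right_interface_def glue_labels_length)
  from glue_out_cases[OF v'(1)] show "v \<in> shifted ` right_interface B NB"
  proof
    assume l: "v < K - m"
    then have "v < K" by simp
    then have "v \<in> right_interface A NA"
      using v' l glue_carr(3) by (simp add: right_interface_def glue_out_A glue_labels_A)
    then show ?thesis using RA l by simp
  next
    assume "\<exists>w. v = shifted w \<and> w < K'"
    then obtain w where w: "v = shifted w" "w < K'" by blast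
    have "NB ! w = Bullet" using v'(2) glue_labels_B[OF w(2)] w(1) by simp
    moreover have "out_edges B w = {}" using v'(3) unfolding w(1) glue_out_B by simp
    ultimately have "w \<in> right_interface B NB" using w(2) glue_carr(4) by (simp add: right_interface_def)
    then show ?thesis using w(1) by blast
  qed
next
  fix v assume "v \<in> shifted ` right_interface B NB"
  then obtain w where w: "v = shifted w" "w \<in> right_interface B NB" by blast
  then have w': "w < K'" "NB ! w = Bullet" "out_edges B w = {}"
    using glue_carr(4) by (simp_all add: right_interface_def)
  have "shifted w < K + K' - m" using w'(1) mK by arith
  moreover have "out_edges glue_mat (shifted w) = {}" unfolding glue_out_B w'(3) by simp
  moreover have "glue_labels ! shifted w = Bullet" using glue_labels_B[OF w'(1)] w'(2) by simp
  ultimately show "v \<in> right_interface glue_mat glue_labels"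
    unfolding w(1) by (simp add: right_interface_def glue_labels_length)
qed

lemma glue_hypergraph: "labelled_hypergraph \<Sigma> (K + K' - m) glue_mat glue_labels"
proof -
  have "set glue_labels \<subseteq> insert Bullet (Circ ` ops \<Sigma>)"
  proof -
    have "set NA \<subseteq> insert Bullet (Circ ` ops \<Sigma>)" "set NB \<subseteq> insert Bullet (Circ ` ops \<Sigma>)"
      using A B by (simp_all add: labelled_hypergraph_def)
    then show ?thesis using set_drop_subset[of m NB] unfolding glue_labels_def set_append by blast
  qed
  moreover have "acyclic (edges glue_mat)"
    unfolding glue_edges
  proof (rule acyclic_sequential)
    show "acyclic (edges A)" using A by (simp add: labelled_hypergraph_def)
    show "acyclic (map_prod shifted shifted ` edges B)"
    proof (rule acyclic_hom[where h = "\<lambda>x. x - (K - m)" and s = "edges B"])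
      fix x y assume "(x, y) \<in> map_prod shifted shifted ` edges B"
      then obtain j i where "(j, i) \<in> edges B" "x = shifted j" "y = shifted i" by auto
      then show "(x - (K - m), y - (K - m)) \<in> edges B" by (metis add_diff_cancel_right')
    qed (use B in \<open>simp add: labelled_hypergraph_def\<close>)
    show "map_prod shifted shifted ` edges B O edges A = {}"
    proof -
      have "(y, z) \<notin> edges A" if xy: "(x, y) \<in> map_prod shifted shifted ` edges B" for x y z
      proof
        assume yz: "(y, z) \<in> edges A"
        obtain j i where "(j, i) \<in> edges B" "y = shifted i" using xy by auto
        then show False using glue_src_A[OF yz] by simp
      qed
      then show ?thesis by blast
    qed
  qed
  moreover have "(glue_labels ! j = Bullet) \<noteq> (glue_labels ! i = Bullet)" if ji: "(j, i) \<in> edges glue_mat" for j i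
    using ji[unfolded glue_edges]
  proof
    assume e: "(j, i) \<in> edges A"
    then have "j < K" "i < K" using glue_src_A[OF e] by linarith+
    moreover have "(NA ! j = Bullet) \<noteq> (NA ! i = Bullet)"
      using A e unfolding labelled_hypergraph_def by blast
    ultimately show ?thesis by (simp add: glue_labels_A)
  next
    assume "(j, i) \<in> map_prod shifted shifted ` edges B"
    then obtain j' i' where e: "(j', i') \<in> edges B" and ji: "j = shifted j'" "i = shifted i'" by auto
    have "(NB ! j' = Bullet) \<noteq> (NB ! i' = Bullet)"
      using B e unfolding labelled_hypergraph_def by blast
    then show ?thesis unfolding ji using glue_tgt_B[OF e] glue_labels_B[of j'] glue_labels_B[of i'] by metis
  qed
  moreover have "card (in_edges glue_mat v) \<le> 1" if v: "v < K + K' - m" "glue_labels ! v = Bullet" for v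
    using glue_in_cases[OF v(1)]
  proof
    assume l: "v < K"
    then have "NA ! v = Bullet" using v glue_labels_A by simp
    then show ?thesis using A l unfolding glue_in_A[OF l] labelled_hypergraph_def by blast
  next
    assume "\<exists>w. v = shifted w \<and> m \<le> w \<and> w < K'"
    then obtain w where w: "v = shifted w" "m \<le> w" "w < K'" by blast
    then have "NB ! w = Bullet" using v glue_labels_B by metis
    then have "card (in_edges B w) \<le> 1" using B w(3) unfolding labelled_hypergraph_def by blast
    then show ?thesis unfolding w(1) glue_in_B[OF w(2)] card_image[OF shifted_inj] .
  qed
  moreover have "card (out_edges glue_mat v) \<le> 1" if v: "v < K + K' - m" "glue_labels ! v = Bullet" for v
    using glue_out_cases[OF v(1)]
  proof
    assume l: "v < K - m"
    then have l': "v < K" by simp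
    then have "NA ! v = Bullet" using v glue_labels_A by simp
    then show ?thesis using A l' unfolding glue_out_A[OF l] labelled_hypergraph_def by blast
  next
    assume "\<exists>w. v = shifted w \<and> w < K'"
    then obtain w where w: "v = shifted w" "w < K'" by blast
    then have "NB ! w = Bullet" using v glue_labels_B by metis
    then have "card (out_edges B w) \<le> 1" using B w(2) unfolding labelled_hypergraph_def by blast
    then show ?thesis unfolding w(1) glue_out_B card_image[OF shifted_inj] .
  qed
  moreover have "bij_betw (edge_label glue_mat) (in_edges glue_mat v) {1..arity \<Sigma> g} \<and>
      bij_betw (edge_label glue_mat) (out_edges glue_mat v) {1..coarity \<Sigma> g}"
    if v: "v < K + K' - m" "glue_labels ! v = Circ g" for v g
    using glue_in_cases[OF v(1)]
  proof
    assume l: "v < K"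
    then have NA: "NA ! v = Circ g" using v glue_labels_A by simp
    then have "v \<notin> right_interface A NA" by (simp add: right_interface_def)
    then have l': "v < K - m" using RA l by auto
    have *: "bij_betw (edge_label A) (in_edges A v) {1..arity \<Sigma> g}"
      "bij_betw (edge_label A) (out_edges A v) {1..coarity \<Sigma> g}"
      using A l NA unfolding labelled_hypergraph_def by blast+
    have "bij_betw (edge_label glue_mat) (in_edges A v) X = bij_betw (edge_label A) (in_edges A v) X"
      "bij_betw (edge_label glue_mat) (out_edges A v) X = bij_betw (edge_label A) (out_edges A v) X" for X
      by (intro bij_betw_cong glue_label_A; simp add: in_edges_def out_edges_def)+
    then show ?thesis unfolding glue_in_A[OF l] glue_out_A[OF l'] using * by blast
  next
    assume "\<exists>w. v = shifted w \<and> m \<le> w \<and> w < K'"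
    then obtain w where w: "v = shifted w" "m \<le> w" "w < K'" by blast
    then have "NB ! w = Circ g" using v glue_labels_B by metis
    then have *: "bij_betw (edge_label B) (in_edges B w) {1..arity \<Sigma> g}"
      "bij_betw (edge_label B) (out_edges B w) {1..coarity \<Sigma> g}"
      using B w(3) unfolding labelled_hypergraph_def by blast+
    have i: "edge_label glue_mat (map_prod shifted shifted e) = edge_label B e" if "e \<in> in_edges B w" for e
      using that by (intro glue_label_B) (simp add: in_edges_def)
    have o: "edge_label glue_mat (map_prod shifted shifted e) = edge_label B e" if "e \<in> out_edges B w" for e
      using that by (intro glue_label_B) (simp add: out_edges_def)
    show ?thesis unfolding w(1) glue_in_B[OF w(2)] glue_out_B
      using bij_betw_relabel[OF *(1) shifted_inj i] bij_betw_relabel[OF *(2) shifted_inj o] by blast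
  qed
  ultimately show ?thesis
    unfolding labelled_hypergraph_def using glue_carrier glue_labels_length by blast
qed

end

lemma perm_mat_sum_one:
  assumes "q permutes {..<K}"
  shows "perm_mat K q \<oplus>\<^sub>d 1\<^sub>m d = perm_mat (K + d) q"
proof (rule eq_matI)
  fix i j assume "i < dim_row (perm_mat (K + d) q)" "j < dim_col (perm_mat (K + d) q)"
  then show "(perm_mat K q \<oplus>\<^sub>d 1\<^sub>m d) $$ (i, j) = perm_mat (K + d) q $$ (i, j)"
    using perm_lt[OF assms, of j] permutes_not_in[OF assms, of j]
    by (auto simp: direct_sum_def perm_mat_def)
qed (auto simp: direct_sum_def)

definition shift_perm :: "nat \<Rightarrow> (nat \<Rightarrow> nat) \<Rightarrow> nat \<Rightarrow> nat"
  where "shift_perm d q x = (if x < d then x else q (x - d) + d)"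

lemma shift_perm_permutes:
  assumes q: "q permutes {..<K}"
  shows "shift_perm d q permutes {..<d + K}"
proof (rule bij_imp_permutes)
  have "inj (shift_perm d q)"
  proof (rule injI)
    fix x y assume xy: "shift_perm d q x = shift_perm d q y"
    have d: "x < d \<longleftrightarrow> y < d" using xy by (auto simp: shift_perm_def split: if_splits)
    show "x = y"
    proof (cases "x < d")
      case True
      then show ?thesis using xy d by (simp add: shift_perm_def)
    next
      case False
      then have "q (x - d) = q (y - d)" using xy d by (simp add: shift_perm_def)
      then have "x - d = y - d" using injD[OF permutes_inj[OF q]] by blast
      then show ?thesis using False d by arith
    qed
  qed
  moreover have "shift_perm d q x < d + K" if "x < d + K" for x
  proof (cases "x < d")
    case False
    then have "x - d < K" using that by arith
    then have "q (x - d) < K" using perm_lt[OF q] by blast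
    then show ?thesis using False by (simp add: shift_perm_def)
  qed (simp add: shift_perm_def)
  ultimately show "bij_betw (shift_perm d q) {..<d + K} {..<d + K}"
    unfolding bij_betw_def
    by (intro conjI endo_inj_surj) (auto intro: inj_on_subset)
next
  fix x assume "x \<notin> {..<d + K}"
  then have "\<not> x < d" "x - d \<notin> {..<K}" by auto
  then show "shift_perm d q x = x" using permutes_not_in[OF q] by (simp add: shift_perm_def)
qed

lemma perm_mat_one_sum:
  assumes "q permutes {..<K}"
  shows "1\<^sub>m d \<oplus>\<^sub>d perm_mat K q = perm_mat (d + K) (shift_perm d q)"
proof (rule eq_matI)
  fix i j assume "i < dim_row (perm_mat (d + K) (shift_perm d q))"
    "j < dim_col (perm_mat (d + K) (shift_perm d q))"
  then show "(1\<^sub>m d \<oplus>\<^sub>d perm_mat K q) $$ (i, j) = perm_mat (d + K) (shift_perm d q) $$ (i, j)"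
    using perm_lt[OF assms, of "j - d"]
    by (auto simp: direct_sum_def perm_mat_def shift_perm_def)
qed (auto simp: direct_sum_def)

theorem har_comp_is_har:
  assumes f: "is_har \<Sigma> n m f" and g: "is_har \<Sigma> m l g"
  shows "is_har \<Sigma> n l (har_comp m f g)"
proof -
  define K K' where "K = har_K f" and "K' = har_K g"
  obtain lf rf where lf: "lf permutes {..<K}" "har_L f = perm_mat K lf"
    and rf: "rf permutes {..<K}" "har_R f = perm_mat K rf"
    using f by (auto simp: is_har_def is_perm_mat_def K_def)
  obtain lg rg where lg: "lg permutes {..<K'}" "har_L g = perm_mat K' lg"
    and rg: "rg permutes {..<K'}" "har_R g = perm_mat K' rg"
    using g by (auto simp: is_har_def is_perm_mat_def K'_def)
  have hf: "labelled_hypergraph \<Sigma> K (har_M f) (har_N f)"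
    and hg: "labelled_hypergraph \<Sigma> K' (har_M g) (har_N g)"
    using f g by (auto simp: is_har_def K_def K'_def)
  then have cf: "har_M f \<in> carrier_mat K K" "length (har_N f) = K"
    and cg: "har_M g \<in> carrier_mat K' K'" "length (har_N g) = K'"
    by (auto simp: labelled_hypergraph_def)
  define A NA where "A = har_M (right_order f)" and "NA = har_N (right_order f)"
  define B NB where "B = har_M (left_order g)" and "NB = har_N (left_order g)"
  have rA: "reordered K rf (har_M f) (har_N f) A NA"
    using reorderedI[OF rf(1) cf] by (simp add: A_def NA_def right_order_def rf)
  have rB: "reordered K' lg (har_M g) (har_N g) B NB"
    using reorderedI[OF lg(1) cg] by (simp add: B_def NB_def left_order_def lg)
  have rFL: "reordered K lf (har_M f) (har_N f) (har_M (left_order f)) (har_N (left_order f))"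
    using reorderedI[OF lf(1) cf] by (simp add: left_order_def lf)
  have rGR: "reordered K' rg (har_M g) (har_N g) (har_M (right_order g)) (har_N (right_order g))"
    using reorderedI[OF rg(1) cg] by (simp add: right_order_def rg)
  have hA: "labelled_hypergraph \<Sigma> K A NA" using re_hypergraph[OF rA hf] .
  have hB: "labelled_hypergraph \<Sigma> K' B NB" using re_hypergraph[OF rB hg] .
  have RA: "right_interface A NA = {K - m..<K}" using f by (simp add: is_har_def A_def NA_def K_def)
  have LB: "left_interface B NB = {..<m}" using g by (simp add: is_har_def B_def NB_def)
  have "right_interface (har_M f) (har_N f) \<subseteq> {..<K}" using cf by (auto simp: right_interface_def)
  then have mK: "m \<le> K" using f card_mono[of "{..<K}"] by (fastforce simp: is_har_def)
  have "right_interface (har_M g) (har_N g) \<subseteq> {..<K'}" using cg by (auto simp: right_interface_def)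
  then have lK': "l \<le> K'" using g card_mono[of "{..<K'}"] by (fastforce simp: is_har_def)
  have mK': "m \<le> K'" using glue_mK'[OF hA hB RA LB mK] .
  define G NG where "G = glue_mat K K' m A B" and "NG = glue_labels m NA NB"
  note ctx = hA hB RA LB mK
  have hG: "labelled_hypergraph \<Sigma> (K + K' - m) G NG"
    unfolding G_def NG_def by (rule glue_hypergraph[OF ctx])
  then have cG: "G \<in> carrier_mat (K + K' - m) (K + K' - m)" "length NG = K + K' - m"
    by (auto simp: labelled_hypergraph_def)
  have LG: "left_interface G NG = left_interface A NA"
    unfolding G_def NG_def by (rule glue_left[OF ctx])
  have RG: "right_interface G NG = (\<lambda>x. x + (K - m)) ` right_interface B NB"
    unfolding G_def NG_def by (rule glue_right[OF ctx])
  define q where "q = lf \<circ> inv_into UNIV rf"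
  define q' where "q' = rg \<circ> inv_into UNIV lg"
  have q: "q permutes {..<K}" unfolding q_def by (intro permutes_compose permutes_inv rf lf)
  have q': "q' permutes {..<K'}" unfolding q'_def by (intro permutes_compose permutes_inv rg lg)
  define Q where "Q = shift_perm (K - m) q'"
  have qG: "q permutes {..<K + K' - m}" using permutes_subset[OF q] mK' by simp
  have QG: "Q permutes {..<K + K' - m}"
    using shift_perm_permutes[OF q', of "K - m"] mK by (simp add: Q_def)
  have comp: "har_comp m f g = \<lparr>har_K = K + K' - m, har_M = G,
      har_L = perm_mat (K + K' - m) q, har_R = perm_mat (K + K' - m) Q, har_N = NG\<rparr>"
  proof -
    have "har_L (right_order f) = perm_mat K q"
      using perm_mat_comp[OF rf(1) lf(1)] by (simp add: right_order_def q_def rf lf)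
    moreover have "har_R (left_order g) = perm_mat K' q'"
      using perm_mat_comp[OF lg(1) rg(1)] by (simp add: left_order_def q'_def rg lg)
    moreover have "G = first_cols (K - m) A \<oplus>\<^sub>d last_rows (K' - m) B" "NG = NA @ drop m NB"
      unfolding G_def NG_def glue_mat_def[OF ctx] glue_labels_def[OF ctx] by (rule refl)+
    ultimately show ?thesis
      using perm_mat_sum_one[OF q, of "K' - m"] perm_mat_one_sum[OF q', of "K - m"] mK mK'
      by (simp add: har_comp_def Q_def A_def NA_def B_def NB_def K_def K'_def)
  qed
  define h where "h = har_comp m f g"
  have rL: "reordered (K + K' - m) q G NG (har_M (left_order h)) (har_N (left_order h))"
    using reorderedI[OF qG cG] by (simp add: h_def comp left_order_def)
  have rR: "reordered (K + K' - m) Q G NG (har_M (right_order h)) (har_N (right_order h))"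
    using reorderedI[OF QG cG] by (simp add: h_def comp right_order_def)
  have "left_interface (har_M (left_order h)) (har_N (left_order h))
      = q ` rf ` left_interface (har_M f) (har_N f)"
    by (simp add: re_left[OF rL] LG re_left[OF rA])
  also have "\<dots> = lf ` left_interface (har_M f) (har_N f)"
    by (simp add: q_def image_image permutes_inverses[OF rf(1)])
  also have "\<dots> = {..<n}" using f re_left[OF rFL] by (simp add: is_har_def)
  finally have 1: "left_interface (har_M (left_order h)) (har_N (left_order h)) = {..<n}" .
  have "right_interface (har_M (right_order h)) (har_N (right_order h))
      = Q ` (\<lambda>x. x + (K - m)) ` lg ` right_interface (har_M g) (har_N g)"
    by (simp add: re_right[OF rR] RG re_right[OF rB])
  also have "\<dots> = (\<lambda>x. x + (K - m)) ` rg ` right_interface (har_M g) (har_N g)"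
  proof -
    have "Q (lg x + (K - m)) = rg x + (K - m)" for x
      by (simp add: Q_def shift_perm_def q'_def permutes_inverses[OF lg(1)] del: add_diff_assoc)
    then show ?thesis unfolding image_image by (rule image_cong[OF refl])
  qed
  also have "\<dots> = (\<lambda>x. x + (K - m)) ` {K' - l..<K'}"
    using g re_right[OF rGR] by (simp add: is_har_def K'_def)
  also have "\<dots> = {K + K' - m - l..<K + K' - m}"
  proof -
    have "K' - l + (K - m) = K + K' - m - l" "K' + (K - m) = K + K' - m" using mK lK' by arith+
    then show ?thesis by (metis image_add_atLeastLessThan')
  qed
  finally have 2: "right_interface (har_M (right_order h)) (har_N (right_order h))
      = {K + K' - m - l..<K + K' - m}" .
  have "left_interface G NG = rf ` left_interface (har_M f) (har_N f)"
    by (simp add: LG re_left[OF rA])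
  then have 3: "card (left_interface G NG) = n"
    using f card_image[OF inj_on_subset[OF permutes_inj[OF rf(1)] subset_UNIV]]
    by (simp add: is_har_def)
  have "right_interface G NG = (\<lambda>x. x + (K - m)) ` lg ` right_interface (har_M g) (har_N g)"
    by (simp add: RG re_right[OF rB])
  then have 4: "card (right_interface G NG) = l"
    using g card_image[OF inj_on_subset[OF permutes_inj[OF lg(1)] subset_UNIV]]
    by (simp add: is_har_def card_image inj_on_def)
  show ?thesis
    using hG qG QG 1 2 3 4
    by (auto simp: is_har_def is_perm_mat_def h_def comp)
qed

end

theory Submission
  imports Defs
begin

text \<open>
  Applied to a sparse row-wise matrix, a reordering only relabels rows and column indices.  A non-empty
  row of the matrix of the composite is therefore a row of \<open>f\<close> relabelled by the permutation of \<open>f_R\<close>, or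
  a row of \<open>g\<close> relabelled by the permutation of \<open>g_L\<close> and shifted by \<open>f_K - m\<close>.  Left interface nodes
  of \<open>g\<close> have no incoming edges, so nothing is lost when the rows of \<open>f\<close> overwrite the \<open>m\<close> shared rows
  already written for \<open>g\<close>.  Reading the single column index in each row of a permutation matrix
  tabulates its permutation in linear time.  A row has at most as many entries as the largest arity in
  the signature (or one), so copying a row takes constant time.
\<close>

section \<open>Structured programs and their cost\<close>

text \<open>No matrix product is ever formed. Row \<open>i\<close> of a permutation matrix has its
  only entry in the column given by the inverse permutation. The left boundary order of the
  composite is \<open>lf \<circ> inv_into UNIV rf\<close> padded by an identity, so its row
  \<open>i\<close> needs the column \<open>rf (inv_into UNIV lf i)\<close>: the stored row of
  \<open>f_L\<close> yields \<open>inv_into UNIV lf i\<close>, and one lookup in the tabulated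
  \<open>rf\<close> yields the rest. The right order is symmetric. Identity rows are written
  beforehand, and each pass corrects only the column cells of its own factor. Inputs lie below the
  first free address and all writing happens from there on, so both passes read unmodified data.
  Labels are copied as opaque numbers and rows by their stored lengths; hence the program is fixed
  and the signature enters only through the bound \<open>C\<close> on the step count. The obstacle
  on the machine side is that jumps are absolute and correctness has to be proved together with a
  step count. Structured commands with a position-independent correctness statement remove
  it.\<close>

datatype com = Block "instr list" | Seq com com | While nat com

fun code_size :: "com \<Rightarrow> nat" where
  "code_size (Block xs) = length xs"
| "code_size (Seq c d) = code_size c + code_size d"
| "code_size (While a c) = code_size c + 3"

text \<open>Register 3 is zeroed so that the conditional jump closing a loop is always taken.\<close>

fun compile :: "nat \<Rightarrow> com \<Rightarrow> instr list" where
  "compile b (Block xs) = xs"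
| "compile b (Seq c d) = compile b c @ compile (b + code_size c) d"
| "compile b (While a c) =
    Jump_Zero a (b + code_size c + 3) # compile (Suc b) c @ [Const 3 0, Jump_Zero 3 b]"

lemma length_compile [simp]: "length (compile b c) = code_size c"
  by (induction c arbitrary: b) auto

text \<open>Jump targets are absolute, so correctness is claimed for the code compiled at its actual
  position between arbitrary \<open>xs\<close> and \<open>ys\<close>; only this form can be reused
  inside larger programs. The run has to reach the first instruction after the command, which makes
  this total correctness with a cost.\<close>

definition wp ::
    "com \<Rightarrow> nat \<Rightarrow> ((nat \<Rightarrow> nat) \<Rightarrow> (nat \<Rightarrow> nat) \<Rightarrow> bool) \<Rightarrow> (nat \<Rightarrow> nat) \<Rightarrow> (nat \<Rightarrow> nat) \<Rightarrow> bool"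
  where "wp c t Q r h \<longleftrightarrow> (\<forall>xs ys. \<exists>k \<le> t. \<exists>r' h'.
    (step (xs @ compile (length xs) c @ ys) ^^ k) \<lparr>pc = length xs, reg = r, mem = h\<rparr>
      = \<lparr>pc = length xs + code_size c, reg = r', mem = h'\<rparr> \<and> Q r' h')"

section \<open>Proof rules with step counts\<close>

lemma wp_mono:
  assumes "wp c t Q r h" "\<And>r h. Q r h \<Longrightarrow> Q' r h" "t \<le> t'"
  shows "wp c t' Q' r h"
  using assms unfolding wp_def by (meson order_trans)

fun is_jump :: "instr \<Rightarrow> bool" where
  "is_jump (Jump_Zero a q) = True"
| "is_jump _ = False"

lemma pc_exec: "\<not> is_jump x \<Longrightarrow> pc (exec x s) = Suc (pc s)"
  by (cases x) auto

lemma step_block: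
  assumes "\<not> (\<exists>x \<in> set zs. is_jump x)" "pc s = length xs"
  shows "(step (xs @ zs @ ys) ^^ length zs) s = fold exec zs s \<and>
    pc (fold exec zs s) = length xs + length zs"
  using assms
proof (induction zs arbitrary: xs s)
  case (Cons z zs)
  have "step (xs @ (z # zs) @ ys) s = exec z s"
    using Cons.prems by (simp add: step_def halted_def)
  then show ?case
    using Cons.IH[of "exec z s" "xs @ [z]"] Cons.prems pc_exec[of z s]
    by (simp add: funpow_swap1)
qed simp

text \<open>Straight-line code is executed symbolically by \<open>fold exec\<close>. The program
  counter never influences registers or memory there, hence the arbitrary start value
  \<open>b\<close>.\<close>

lemma wp_Block:
  assumes "\<not> (\<exists>x \<in> set zs. is_jump x)"
    and "\<And>b. Q (reg (fold exec zs \<lparr>pc = b, reg = r, mem = h\<rparr>))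
               (mem (fold exec zs \<lparr>pc = b, reg = r, mem = h\<rparr>))"
    and "length zs \<le> t"
  shows "wp (Block zs) t Q r h"
  unfolding wp_def
proof (intro allI)
  fix xs ys :: "instr list"
  let ?s = "\<lparr>pc = length xs, reg = r, mem = h\<rparr>"
  show "\<exists>k\<le>t. \<exists>r' h'. (step (xs @ compile (length xs) (Block zs) @ ys) ^^ k) ?s
      = \<lparr>pc = length xs + code_size (Block zs), reg = r', mem = h'\<rparr> \<and> Q r' h'"
    using step_block[OF assms(1), of ?s xs ys] assms(3) assms(2)[of "length xs"]
    by (intro exI[of _ "length zs"] conjI exI[of _ "reg (fold exec zs ?s)"]
        exI[of _ "mem (fold exec zs ?s)"]) auto
qed

lemma wp_Seq:
  assumes "wp c t (wp d u Q) r h"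
  shows "wp (Seq c d) (t + u) Q r h"
  unfolding wp_def
proof (intro allI)
  fix xs ys :: "instr list"
  define prog where "prog = xs @ compile (length xs) (Seq c d) @ ys"
  \<comment> \<open>One program is split in two ways: around \<open>c\<close>, with \<open>d\<close>
    in the trailing context, and around \<open>d\<close>, with \<open>c\<close> in the leading
    context.\<close>
  have p1: "prog = xs @ compile (length xs) c @ (compile (length xs + code_size c) d @ ys)"
    and p2: "prog = (xs @ compile (length xs) c) @
      compile (length (xs @ compile (length xs) c)) d @ ys"
    by (simp_all add: prog_def)
  obtain k r' h' where k: "k \<le> t" "(step prog ^^ k) \<lparr>pc = length xs, reg = r, mem = h\<rparr>
      = \<lparr>pc = length xs + code_size c, reg = r', mem = h'\<rparr>" and d: "wp d u Q r' h'"
    using assms[unfolded wp_def[of c], rule_format, of xs "compile (length xs + code_size c) d @ ys", folded p1] by blast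
  obtain l r'' h'' where l: "l \<le> u"
      "(step prog ^^ l) \<lparr>pc = length xs + code_size c, reg = r', mem = h'\<rparr>
      = \<lparr>pc = length xs + code_size c + code_size d, reg = r'', mem = h''\<rparr>" "Q r'' h''"
    using d[unfolded wp_def, rule_format, of "xs @ compile (length xs) c" ys, folded p2]
    by auto
  have "(step prog ^^ (l + k)) \<lparr>pc = length xs, reg = r, mem = h\<rparr>
      = \<lparr>pc = length xs + code_size c + code_size d, reg = r'', mem = h''\<rparr>"
    using k(2) l(2) by (simp add: funpow_add)
  then show "\<exists>k\<le>t + u. \<exists>r' h'. (step (xs @ compile (length xs) (Seq c d) @ ys) ^^ k)
      \<lparr>pc = length xs, reg = r, mem = h\<rparr>
      = \<lparr>pc = length xs + code_size (Seq c d), reg = r', mem = h'\<rparr> \<and> Q r' h'"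
    using k(1) l(1,3) unfolding prog_def by (intro exI[of _ "l + k"]) (auto simp: add.assoc)
qed

text \<open>The invariant is indexed by the round, so it also supplies termination. A round costs
  the test, the body and the two closing instructions, hence \<open>t + 3\<close>; the last test
  adds 1. The update \<open>r(3 := 0)\<close> is the effect of the closing instruction that prepares
  the backward jump.\<close>

lemma wp_While:
  assumes body: "\<And>i r h. i < n \<Longrightarrow> I i r h \<Longrightarrow> r a \<noteq> 0 \<and> wp c t (\<lambda>r h. I (Suc i) (r(3 := 0)) h) r h"
    and exit: "\<And>r h. I n r h \<Longrightarrow> r a = 0"
    and init: "I 0 r h"
  shows "wp (While a c) (n * (t + 3) + 1) (I n) r h"
proof -
  have "wp (While a c) ((n - i) * (t + 3) + 1) (I n) r h" if "i \<le> n" "I i r h" for i r h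
    using that
  proof (induction arbitrary: r h rule: inc_induct)
    case base
    show ?case
      unfolding wp_def
    proof (intro allI)
      fix xs ys :: "instr list"
      show "\<exists>k\<le>(n - n) * (t + 3) + 1. \<exists>r' h'. (step (xs @ compile (length xs) (While a c) @ ys) ^^ k)
          \<lparr>pc = length xs, reg = r, mem = h\<rparr>
          = \<lparr>pc = length xs + code_size (While a c), reg = r', mem = h'\<rparr> \<and> I n r' h'"
        using exit[OF base] base
        by (intro exI[of _ 1]) (auto simp: step_def halted_def)
    qed
  next
    case (step i)
    show ?case
      unfolding wp_def
    proof (intro allI)
      fix xs ys :: "instr list"
      define prog where "prog = xs @ compile (length xs) (While a c) @ ys"
      have p: "prog = (xs @ [Jump_Zero a (length xs + code_size c + 3)]) @
          compile (length (xs @ [Jump_Zero a (length xs + code_size c + 3)])) c @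
          ([Const 3 0, Jump_Zero 3 (length xs)] @ ys)"
        by (simp add: prog_def)
      have b: "r a \<noteq> 0" "wp c t (\<lambda>r h. I (Suc i) (r(3 := 0)) h) r h"
        using body[of i r h] step by auto
      have 1: "step prog \<lparr>pc = length xs, reg = r, mem = h\<rparr> = \<lparr>pc = Suc (length xs), reg = r, mem = h\<rparr>"
        using b(1) by (simp add: step_def halted_def prog_def)
      have "\<exists>k\<le>t. \<exists>r' h'. (step prog ^^ k) \<lparr>pc = Suc (length xs), reg = r, mem = h\<rparr>
          = \<lparr>pc = Suc (length xs) + code_size c, reg = r', mem = h'\<rparr> \<and> I (Suc i) (r'(3 := 0)) h'"
        using b(2)[unfolded wp_def, rule_format, of "xs @ [Jump_Zero a (length xs + code_size c + 3)]"
            "[Const 3 0, Jump_Zero 3 (length xs)] @ ys", folded p]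
        by simp
      then obtain k r' h' where k: "k \<le> t" "(step prog ^^ k) \<lparr>pc = Suc (length xs), reg = r, mem = h\<rparr>
          = \<lparr>pc = Suc (length xs) + code_size c, reg = r', mem = h'\<rparr>" "I (Suc i) (r'(3 := 0)) h'"
        by blast
      have 2: "step prog \<lparr>pc = Suc (length xs) + code_size c, reg = r', mem = h'\<rparr>
          = \<lparr>pc = Suc (Suc (length xs)) + code_size c, reg = r'(3 := 0), mem = h'\<rparr>"
        by (simp add: step_def halted_def prog_def nth_append)
      have 3: "step prog \<lparr>pc = Suc (Suc (length xs)) + code_size c, reg = r'(3 := 0), mem = h'\<rparr>
          = \<lparr>pc = length xs, reg = r'(3 := 0), mem = h'\<rparr>"
        by (simp add: step_def halted_def prog_def nth_append Suc_diff_le)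
      have "\<exists>l\<le>(n - Suc i) * (t + 3) + 1. \<exists>r'' h''. (step prog ^^ l) \<lparr>pc = length xs, reg = r'(3 := 0), mem = h'\<rparr>
          = \<lparr>pc = length xs + code_size (While a c), reg = r'', mem = h''\<rparr> \<and> I n r'' h''"
        using step.IH[OF k(3)] unfolding wp_def prog_def by blast
      then obtain l r'' h'' where l: "l \<le> (n - Suc i) * (t + 3) + 1"
          "(step prog ^^ l) \<lparr>pc = length xs, reg = r'(3 := 0), mem = h'\<rparr>
          = \<lparr>pc = length xs + code_size (While a c), reg = r'', mem = h''\<rparr>" "I n r'' h''"
        by blast
      have k1: "(step prog ^^ k) ((step prog ^^ 1) \<lparr>pc = length xs, reg = r, mem = h\<rparr>)
          = \<lparr>pc = Suc (length xs) + code_size c, reg = r', mem = h'\<rparr>"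
        using 1 k(2) by simp
      have "(step prog ^^ (l + (Suc (Suc (k + 1))))) \<lparr>pc = length xs, reg = r, mem = h\<rparr>
          = \<lparr>pc = length xs + code_size (While a c), reg = r'', mem = h''\<rparr>"
        unfolding funpow_add o_apply funpow.simps(2) k1 2 3 using l(2) .
      moreover have "n - i = Suc (n - Suc i)" using step.hyps by simp
      then have "l + (Suc (Suc (k + 1))) \<le> (n - i) * (t + 3) + 1" using l(1) k(1) by simp
      ultimately show "\<exists>k\<le>(n - i) * (t + 3) + 1. \<exists>r' h'.
          (step (xs @ compile (length xs) (While a c) @ ys) ^^ k) \<lparr>pc = length xs, reg = r, mem = h\<rparr>
          = \<lparr>pc = length xs + code_size (While a c), reg = r', mem = h'\<rparr> \<and> I n r' h'"
        using l(3) unfolding prog_def by blast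
    qed
  qed
  from this[of 0] show ?thesis using init by simp
qed

text \<open>With empty context the end of the command is the end of the program, which is what
  halting means.\<close>

lemma wp_halts_within:
  assumes "wp c t Q (reg s) (mem s)" "pc s = 0"
  shows "\<exists>s'. halts_within (compile 0 c) t s s' \<and> Q (reg s') (mem s')"
proof -
  obtain k r' h' where "k \<le> t" "(step (compile 0 c) ^^ k) \<lparr>pc = 0, reg = reg s, mem = mem s\<rparr>
      = \<lparr>pc = code_size c, reg = r', mem = h'\<rparr>" "Q r' h'"
    using assms(1)[unfolded wp_def, rule_format, of "[]" "[]"] by auto
  moreover have "\<lparr>pc = 0, reg = reg s, mem = mem s\<rparr> = s" using assms(2) by simp
  ultimately show ?thesis
    by (intro exI[of _ "\<lparr>pc = code_size c, reg = r', mem = h'\<rparr>"])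
      (auto simp: halts_within_def halted_def)
qed

section \<open>Copying a HAR\<close>

text \<open>
  Register conventions: 3 is scratch and holds 0 after every loop round, 4 holds 1, 10 to 19 are the
  arguments of a copying pass, 20 is the first free address, 21 to 39 are temporaries, and registers
  from 40 on hold the global data of the composition.
\<close>

definition invert_perm :: com
  where "invert_perm = Seq
    (Block [Const 3 0, Add 21 10 3, Add 22 11 4, Add 23 15 3])
    (While 21 (Block [Load 24 22, Load 24 24, Add 24 24 16, Store 24 23,
      Add 23 23 4, Add 22 22 4, Add 22 22 4, Sub 21 21 4]))"

definition copy_row :: com
  where "copy_row = While 31 (Block [Load 24 32, Add 24 24 16, Load 24 24, Add 32 32 4, Load 33 32,
    Store 20 24, Add 20 20 4, Store 20 33, Add 20 20 4, Add 32 32 4, Sub 31 31 4])"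

definition copy_har :: com
  where "copy_har = Seq
    (Block [Const 3 0, Add 21 10 3, Add 22 12 4, Add 25 13 3, Add 26 14 3, Add 27 15 15,
      Add 27 27 17, Add 28 16 3])
    (While 21 (Seq
      (Block [Load 24 22, Load 24 24, Add 24 24 16, Load 24 24, Load 29 28, Load 33 26,
        Add 30 18 29, Add 29 29 29, Add 29 29 19, Add 34 29 4, Load 31 25, Add 25 25 4, Load 32 25,
        Store 27 24, Store 30 33, Store 29 31, Store 34 20,
        Add 25 25 4, Add 22 22 4, Add 22 22 4, Add 26 26 4, Add 27 27 4, Add 27 27 4,
        Add 28 28 4, Sub 21 21 4])
      copy_row))"

text \<open>Register 3 is exempt because every loop zeroes it, register 20 because allocation
  advances it.\<close>

definition saved :: "(nat \<Rightarrow> nat) \<Rightarrow> (nat \<Rightarrow> nat) \<Rightarrow> bool"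
  where "saved r r' \<longleftrightarrow> (\<forall>x. x \<noteq> 3 \<longrightarrow> x < 20 \<or> 40 \<le> x \<longrightarrow> r' x = r x)"

lemma saved_refl: "saved r r"
  by (simp add: saved_def)

lemma saved_trans: "saved r r' \<Longrightarrow> saved r' r'' \<Longrightarrow> saved r r''"
  by (simp add: saved_def)

lemma saved_upd: "saved r r' \<Longrightarrow> x = 3 \<or> 20 \<le> x \<and> x < 40 \<Longrightarrow> saved r (r'(x := v))"
  by (auto simp: saved_def)

text \<open>
  One pass copies a HAR of size \<open>n\<close> found in the memory \<open>inp\<close> below address \<open>F\<close>, sending vertex \<open>k\<close> to
  \<open>off + p k\<close>.  The matrix at \<open>aP\<close> is that of \<open>p\<close>, whose values are tabulated at \<open>V\<close>.  The matrix at \<open>aQ\<close>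
  belongs to the other boundary order and has its entry of row \<open>k\<close> in column \<open>cq k\<close>.  Labels go to
  the array at \<open>NO\<close>, rows to the table at \<open>MT\<close>, and the entries of the permutation matrix to \<open>QE\<close>.
\<close>

locale copying_pass =
  fixes inp :: "nat \<Rightarrow> nat" and F n S C aP aQ aM aN off V NO MT QE :: nat and p cq :: "nat \<Rightarrow> nat"
  assumes p: "p permutes {..<n}"
    and off: "off + n \<le> S"
    and layout: "F \<le> V" "V + n \<le> NO" "NO + S \<le> MT" "MT + 2 * S \<le> QE"
    and P: "aP + 2 * n \<le> F"
      "k < n \<Longrightarrow> inp (aP + 2 * p k + 1) < F \<and> inp (inp (aP + 2 * p k + 1)) = k"
    and Q: "aQ + 2 * n \<le> F"
      "k < n \<Longrightarrow> inp (aQ + 2 * k + 1) < F \<and> inp (inp (aQ + 2 * k + 1)) = cq k \<and> cq k < n"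
    and M: "aM + 2 * n \<le> F"
      "k < n \<Longrightarrow> inp (aM + 2 * k) \<le> C \<and> inp (aM + 2 * k + 1) + 2 * inp (aM + 2 * k) \<le> F"
      "k < n \<Longrightarrow> t < inp (aM + 2 * k) \<Longrightarrow> inp (inp (aM + 2 * k + 1) + 2 * t) < n"
    and N: "aN + n \<le> F"
begin

definition params :: "(nat \<Rightarrow> nat) \<Rightarrow> bool"
  where "params r \<longleftrightarrow> r 4 = 1 \<and> r 10 = n \<and> r 11 = aP \<and> r 12 = aQ \<and> r 13 = aM \<and> r 14 = aN \<and>
    r 15 = off \<and> r 16 = V \<and> r 17 = QE \<and> r 18 = NO \<and> r 19 = MT"

lemma saved_params: "saved r r' \<Longrightarrow> params r \<Longrightarrow> params r'"
  by (simp add: saved_def params_def)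

lemma wp_invert_perm:
  assumes r: "params r" and h: "\<forall>x<F. h x = inp x"
  shows "wp invert_perm (4 + (n * (8 + 3) + 1)) (\<lambda>r' h'. saved r r' \<and> r' 20 = r 20 \<and>
    (\<forall>x. x < V \<or> V + n \<le> x \<longrightarrow> h' x = h x) \<and> (\<forall>k<n. h' (V + k) = off + p k)) r h"
proof -
  \<comment> \<open>Row \<open>i\<close> contains the column \<open>j\<close> with
    \<open>p j = i\<close>, and the round writes \<open>off + i\<close> to cell
    \<open>V + j\<close>. The cells filled after \<open>i\<close> rounds are therefore those with
    \<open>p k < i\<close>, scattered over the table rather than an initial segment.\<close>
  define I where "I = (\<lambda>i r' h'. saved r r' \<and> r' 20 = r 20 \<and> r' 21 = n - i \<and> r' 22 = aP + 1 + 2 * i \<and>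
    r' 23 = off + i \<and> (\<forall>x. x < V \<or> V + n \<le> x \<longrightarrow> h' x = h x) \<and>
    (\<forall>k<n. p k < i \<longrightarrow> h' (V + k) = off + p k))"
  have body: "r' 21 \<noteq> 0 \<and> wp (Block [Load 24 22, Load 24 24, Add 24 24 16, Store 24 23,
      Add 23 23 4, Add 22 22 4, Add 22 22 4, Sub 21 21 4]) 8 (\<lambda>r h. I (Suc i) (r(3 := 0)) h) r' h'"
    if i: "i < n" and I: "I i r' h'" for i r' h'
  proof -
    have pr: "r' 4 = 1" "r' 16 = V" using I r saved_params by (auto simp: I_def params_def)
    obtain j where j: "j < n" "p j = i" using i permutes_image[OF p] by (metis imageE lessThan_iff)
    have *: "inp (aP + 2 * i + 1) < F" "inp (inp (aP + 2 * i + 1)) = j" using P(2) j by auto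
    have "aP + 2 * i + 1 < F" using P(1) i by simp
    then have "h' (aP + 2 * i + 1) = inp (aP + 2 * i + 1)" using I h layout(1) by (simp add: I_def)
    moreover have "h' (inp (aP + 2 * i + 1)) = j" using * I h layout(1) by (simp add: I_def)
    ultimately have j': "h' (h' (Suc (aP + 2 * i))) = j" by simp
    have "p k = p j \<longleftrightarrow> k = j" for k using permutes_inj[OF p] by (simp add: inj_eq)
    then have pk: "p k < Suc i \<longleftrightarrow> p k < i \<or> k = j" for k using j by (auto simp: less_Suc_eq)
    show ?thesis
    proof
      show "r' 21 \<noteq> 0" using I i by (simp add: I_def)
      show "wp (Block [Load 24 22, Load 24 24, Add 24 24 16, Store 24 23,
        Add 23 23 4, Add 22 22 4, Add 22 22 4, Sub 21 21 4]) 8 (\<lambda>r h. I (Suc i) (r(3 := 0)) h) r' h'"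
        by (rule wp_Block) (use I i pr j j' pk in \<open>auto simp: I_def saved_upd\<close>)
    qed
  qed
  have exit: "I n r' h' \<Longrightarrow> r' 21 = 0" for r' h' by (simp add: I_def)
  have "I 0 r' h \<Longrightarrow> wp (While 21 (Block [Load 24 22, Load 24 24, Add 24 24 16, Store 24 23,
      Add 23 23 4, Add 22 22 4, Add 22 22 4, Sub 21 21 4])) (n * (8 + 3) + 1) (\<lambda>r' h'. saved r r' \<and> r' 20 = r 20 \<and>
    (\<forall>x. x < V \<or> V + n \<le> x \<longrightarrow> h' x = h x) \<and> (\<forall>k<n. h' (V + k) = off + p k)) r' h" for r'
    by (rule wp_mono, rule wp_While[where n = n and I = I], erule (1) body, erule exit)
      (use perm_lt[OF p] in \<open>auto simp: I_def\<close>)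
  then show ?thesis
    unfolding invert_perm_def using r
    by (intro wp_Seq wp_Block) (auto simp: I_def params_def saved_upd saved_refl)
qed

text \<open>\<open>E\<close> is the allocation pointer at the start of the pass. From
  \<open>E\<close> on, fresh row lists may be written; below it, only the output cells of this
  factor change. Among the entries at \<open>QE\<close> only column cells are exempt: the values are
  already 1.\<close>

definition frame :: "nat \<Rightarrow> (nat \<Rightarrow> nat) \<Rightarrow> (nat \<Rightarrow> nat) \<Rightarrow> bool"
  where "frame E h h' \<longleftrightarrow> (\<forall>x<E. x \<notin> {NO + off..<NO + off + n} \<longrightarrow>
    x \<notin> {MT + 2 * off..<MT + 2 * off + 2 * n} \<longrightarrow> (\<forall>k<n. x \<noteq> QE + 2 * (off + k)) \<longrightarrow> h' x = h x)"

text \<open>The bounds confine the row list to the addresses from \<open>E\<close> up to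
  \<open>e\<close>. Later table writes stay below \<open>E\<close> and later lists start at
  \<open>e\<close> or beyond, so neither disturbs it.\<close>

definition copied :: "nat \<Rightarrow> (nat \<Rightarrow> nat) \<Rightarrow> nat \<Rightarrow> nat \<Rightarrow> bool"
  where "copied E h e k \<longleftrightarrow>
    h (NO + (off + p k)) = inp (aN + k) \<and>
    h (QE + 2 * (off + k)) = off + p (cq k) \<and>
    h (MT + 2 * (off + p k)) = inp (aM + 2 * k) \<and>
    E \<le> h (MT + 2 * (off + p k) + 1) \<and>
    h (MT + 2 * (off + p k) + 1) + 2 * inp (aM + 2 * k) \<le> e \<and>
    (\<forall>t < inp (aM + 2 * k).
      h (h (MT + 2 * (off + p k) + 1) + 2 * t) = off + p (inp (inp (aM + 2 * k + 1) + 2 * t)) \<and>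
      h (h (MT + 2 * (off + p k) + 1) + 2 * t + 1) = inp (inp (aM + 2 * k + 1) + 2 * t + 1))"

lemma copied_extend:
  assumes k: "k < n" and c: "copied E h e k" and le: "QE + 2 * S \<le> E" "E \<le> e" "e \<le> e'"
    and agree: "\<forall>x<e. h' x = h x"
  shows "copied E h' e' k"
proof -
  have pk: "p k < n" using perm_lt[OF p] k by simp
  have "NO + (off + p k) < e" "QE + 2 * (off + k) < e" "MT + 2 * (off + p k) + 1 < e"
    using pk k le layout off by simp_all
  then have a: "h' (NO + (off + p k)) = h (NO + (off + p k))"
      "h' (QE + 2 * (off + k)) = h (QE + 2 * (off + k))"
      "h' (MT + 2 * (off + p k)) = h (MT + 2 * (off + p k))"
      "h' (MT + 2 * (off + p k) + 1) = h (MT + 2 * (off + p k) + 1)"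
    using agree by auto
  then show ?thesis using c le(3) agree unfolding copied_def a by auto
qed

text \<open>Different vertices own different cells: \<open>p\<close> is injective, the parity of the
  offset from \<open>MT\<close> separates counts from addresses, and all row lists lie above the
  tables.\<close>

lemma copied_update:
  assumes k: "k < n" and i: "i < n" "k \<noteq> i" and c: "copied E h e k" and le: "QE + 2 * S \<le> E"
    and h': "\<And>x. x \<noteq> QE + 2 * (off + i) \<Longrightarrow> x \<noteq> NO + (off + p i) \<Longrightarrow>
      x \<noteq> MT + 2 * (off + p i) \<Longrightarrow> x \<noteq> MT + 2 * (off + p i) + 1 \<Longrightarrow> h' x = h x"
  shows "copied E h' e k"
proof -
  have pk: "p k < n" "p i < n" using perm_lt[OF p] k i by simp_all
  have ne: "p k \<noteq> p i" using i(2) permutes_inj[OF p] by (simp add: inj_eq)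
  have ge: "h' x = h x" if "E \<le> x" for x
  proof -
    have "QE + 2 * (off + i) < x" "NO + (off + p i) < x" "MT + 2 * (off + p i) + 1 < x"
      using that pk i(1) le layout off by simp_all
    then show ?thesis by (intro h') simp_all
  qed
  have par: "MT + 2 * (off + p k) \<noteq> MT + 2 * (off + p i) + 1"
    "MT + 2 * (off + p k) + 1 \<noteq> MT + 2 * (off + p i)" by presburger+
  have bounds: "NO + (off + p k) < MT" "NO + (off + p i) < MT" "MT + 2 * (off + p k) + 1 < QE"
      "MT + 2 * (off + p i) + 1 < QE"
    using pk layout off by simp_all
  have "h' (NO + (off + p k)) = h (NO + (off + p k))"
    by (rule h') (use ne bounds in simp_all)
  moreover have "h' (QE + 2 * (off + k)) = h (QE + 2 * (off + k))"
    by (rule h') (use i(2) bounds in simp_all)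
  moreover have "h' (MT + 2 * (off + p k)) = h (MT + 2 * (off + p k))"
    by (rule h') (use bounds par ne in simp_all)
  moreover have "h' (MT + 2 * (off + p k) + 1) = h (MT + 2 * (off + p k) + 1)"
    by (rule h') (use bounds par ne in simp_all)
  ultimately show ?thesis using c ge unfolding copied_def by simp
qed

text \<open>The loop runs once per entry, but its time is stated with the uniform bound
  \<open>C\<close>, since the enclosing loop needs one bound for all rounds. The table at
  \<open>V\<close> ends below the allocation pointer, so copying never destroys what it still has to
  read.\<close>

lemma wp_copy_row:
  assumes V: "r 16 = V" "r 4 = 1" "\<forall>k<n. h (V + k) = off + p k"
    and i: "i < n" and e: "V + n \<le> r 20" and inp: "\<forall>x<F. h x = inp x"
    and r: "r 31 = inp (aM + 2 * i)" "r 32 = inp (aM + 2 * i + 1)"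
  shows "wp copy_row (C * (11 + 3) + 1) (\<lambda>r' h'. saved r r' \<and> (\<forall>x \<in> {21..28}. x \<noteq> 24 \<longrightarrow> r' x = r x) \<and>
    r' 20 = r 20 + 2 * inp (aM + 2 * i) \<and> (\<forall>x < r 20. h' x = h x) \<and>
    (\<forall>t < inp (aM + 2 * i). h' (r 20 + 2 * t) = off + p (inp (inp (aM + 2 * i + 1) + 2 * t)) \<and>
      h' (r 20 + 2 * t + 1) = inp (inp (aM + 2 * i + 1) + 2 * t + 1))) r h"
proof -
  define d q where "d = inp (aM + 2 * i)" and "q = inp (aM + 2 * i + 1)"
  have d: "d \<le> C" "q + 2 * d \<le> F" "\<And>t. t < d \<Longrightarrow> inp (q + 2 * t) < n"
    using M(2,3)[OF i] by (auto simp: d_def q_def)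
  define I where "I = (\<lambda>j r' h'. saved r r' \<and> (\<forall>x \<in> {21..28}. x \<noteq> 24 \<longrightarrow> r' x = r x) \<and>
    r' 20 = r 20 + 2 * j \<and> r' 31 = d - j \<and> r' 32 = q + 2 * j \<and> (\<forall>x < r 20. h' x = h x) \<and>
    (\<forall>t < j. h' (r 20 + 2 * t) = off + p (inp (q + 2 * t)) \<and>
      h' (r 20 + 2 * t + 1) = inp (q + 2 * t + 1)))"
  have "wp copy_row (d * (11 + 3) + 1) (I d) r h"
    unfolding copy_row_def
  proof (rule wp_While)
    fix j r' h'
    assume j: "j < d" and I: "I j r' h'"
    have r': "r' 16 = V" "r' 4 = 1" using I V(1,2) by (simp_all add: I_def saved_def)
    have I': "saved r r'" "\<forall>x \<in> {21..28}. x \<noteq> 24 \<longrightarrow> r' x = r x" "r' 20 = r 20 + 2 * j" "r' 31 = d - j"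
        "r' 32 = q + 2 * j" "\<forall>x < r 20. h' x = h x"
        "\<And>t. t < j \<Longrightarrow> h' (r 20 + 2 * t) = off + p (inp (q + 2 * t)) \<and>
          h' (r 20 + 2 * t + 1) = inp (q + 2 * t + 1)"
      using I by (simp_all add: I_def)
    have lt: "q + 2 * j + 1 < r 20" "q + 2 * j + 1 < F" "V + inp (q + 2 * j) < r 20"
      using d(2) d(3)[OF j] j e layout by simp_all
    then have 1: "h' (q + 2 * j) = inp (q + 2 * j)" "h' (Suc (q + 2 * j)) = inp (q + 2 * j + 1)"
      using I'(6) inp by simp_all
    have 2: "h' (inp (q + 2 * j) + V) = off + p (inp (q + 2 * j))"
      using I'(6) lt(3) d(3)[OF j] V(3) by (simp add: add.commute[of _ V])
    define h2 where "h2 = h'(r 20 + 2 * j := off + p (inp (q + 2 * j)),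
      Suc (r 20 + 2 * j) := inp (q + 2 * j + 1))"
    have new: "h2 (r 20 + 2 * t) = off + p (inp (q + 2 * t)) \<and>
        h2 (r 20 + 2 * t + 1) = inp (q + 2 * t + 1)" if "t < Suc j" for t
    proof (cases "t = j")
      case False
      then have "r 20 + 2 * t + 1 < r 20 + 2 * j" using that by simp
      then have "h2 (r 20 + 2 * t) = h' (r 20 + 2 * t)" "h2 (r 20 + 2 * t + 1) = h' (r 20 + 2 * t + 1)"
        by (simp_all add: h2_def)
      then show ?thesis using I'(7)[of t] that False by simp
    qed (simp add: h2_def)
    have old: "\<forall>x < r 20. h2 x = h x" using I'(6) by (simp add: h2_def)
    have step: "I (Suc j) r2 h3" if "saved r r2" "\<forall>x \<in> {21..28}. x \<noteq> 24 \<longrightarrow> r2 x = r' x"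
      "r2 20 = r 20 + 2 * Suc j" "r2 31 = d - Suc j" "r2 32 = q + 2 * Suc j" "h3 = h2" for r2 h3
    proof -
      have "\<forall>x \<in> {21..28}. x \<noteq> 24 \<longrightarrow> r2 x = r x" using that(2) I'(2) by metis
      moreover have "\<forall>t<Suc j. h2 (r 20 + 2 * t) = off + p (inp (q + 2 * t)) \<and>
          h2 (r 20 + 2 * t + 1) = inp (q + 2 * t + 1)" using new by (intro allI impI)
      ultimately show ?thesis unfolding I_def that(6) using that(1,3-5) old by (intro conjI)
    qed
    have nonzero: "r' 31 \<noteq> 0" using I'(4) j by simp
    have "wp (Block [Load 24 32, Add 24 24 16, Load 24 24, Add 32 32 4, Load 33 32,
        Store 20 24, Add 20 20 4, Store 20 33, Add 20 20 4, Add 32 32 4, Sub 31 31 4]) 11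
        (\<lambda>r. I (Suc j) (r(3 := 0))) r' h'"
      by (rule wp_Block; (rule step)?)
        (simp_all add: I'(1,3-5) r' 1 2 saved_upd h2_def)
    then show "r' 31 \<noteq> 0 \<and> wp (Block [Load 24 32, Add 24 24 16, Load 24 24, Add 32 32 4, Load 33 32,
        Store 20 24, Add 20 20 4, Store 20 33, Add 20 20 4, Add 32 32 4, Sub 31 31 4]) 11
        (\<lambda>r. I (Suc j) (r(3 := 0))) r' h'"
      using nonzero by blast
  qed (use r in \<open>auto simp: I_def d_def q_def saved_refl\<close>)
  then show ?thesis
    by (rule wp_mono) (use d(1) in \<open>auto simp: I_def d_def q_def\<close>)
qed

lemma wp_copy_har:
  assumes r: "params r" and inp: "\<forall>x<F. h x = inp x" and V: "\<forall>k<n. h (V + k) = off + p k"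
    and E: "QE + 2 * S \<le> r 20"
  shows "wp copy_har (8 + (n * ((25 + (C * (11 + 3) + 1)) + 3) + 1)) (\<lambda>r' h'. saved r r' \<and> r 20 \<le> r' 20 \<and>
    frame (r 20) h h' \<and> (\<forall>k<n. copied (r 20) h' (r' 20) k)) r h"
proof -
  define I where "I = (\<lambda>i r' h'. saved r r' \<and> r' 21 = n - i \<and> r' 22 = aQ + 1 + 2 * i \<and>
    r' 25 = aM + 2 * i \<and> r' 26 = aN + i \<and> r' 27 = QE + 2 * (off + i) \<and> r' 28 = V + i \<and>
    r 20 \<le> r' 20 \<and> frame (r 20) h h' \<and> (\<forall>k<i. copied (r 20) h' (r' 20) k))"
  let ?b = "Block [Load 24 22, Load 24 24, Add 24 24 16, Load 24 24, Load 29 28, Load 33 26,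
        Add 30 18 29, Add 29 29 29, Add 29 29 19, Add 34 29 4, Load 31 25, Add 25 25 4, Load 32 25,
        Store 27 24, Store 30 33, Store 29 31, Store 34 20,
        Add 25 25 4, Add 22 22 4, Add 22 22 4, Add 26 26 4, Add 27 27 4, Add 27 27 4,
        Add 28 28 4, Sub 21 21 4]"
  have body: "r' 21 \<noteq> 0 \<and> wp (Seq ?b copy_row) (25 + (C * (11 + 3) + 1)) (\<lambda>r h. I (Suc i) (r(3 := 0)) h) r' h'"
    if i: "i < n" and I: "I i r' h'" for i r' h'
  proof -
    have pr: "r' 4 = 1" "r' 16 = V" "r' 18 = NO" "r' 19 = MT"
      using I r saved_params by (auto simp: I_def params_def)
    have fr: "frame (r 20) h h'" using I by (simp add: I_def)
    \<comment> \<open>All cells exempt from \<open>frame\<close> below the allocation pointer lie at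
      \<open>NO\<close> or above, so the inputs and the table at \<open>V\<close> stay readable in
      every round.\<close>
    have low: "h' x = h x" if "x < NO" for x
      using fr that layout off E by (auto simp: frame_def)
    have lowF: "h' x = inp x" if "x < F" for x using low[of x] that inp layout by simp
    have lowV: "h' (V + k) = off + p k" if "k < n" for k
      using low[of "V + k"] that V layout by simp
    have pi: "p i < n" using perm_lt[OF p] i by simp
    have l1: "h' (h' (Suc (aQ + 2 * i))) = cq i"
      using Q(1) Q(2)[OF i] i by (simp add: lowF)
    have l2: "h' (cq i + V) = off + p (cq i)" using Q(2)[OF i] lowV[of "cq i"] by (simp add: add.commute)
    have l3: "h' (aN + i) = inp (aN + i)" using N i lowF by simp
    have l4: "h' (aM + 2 * i) = inp (aM + 2 * i)" "h' (Suc (aM + 2 * i)) = inp (aM + 2 * i + 1)"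
      using M(1) i lowF by simp_all
    \<comment> \<open>The memory after the four table stores and before the row is copied; the row
      address entered is the current allocation pointer.\<close>
    define h1 where "h1 = h'(QE + 2 * (off + i) := off + p (cq i), NO + (off + p i) := inp (aN + i),
      MT + 2 * (off + p i) := inp (aM + 2 * i), MT + 2 * (off + p i) + 1 := r' 20)"
    have le: "r 20 \<le> r' 20" "QE + 2 * S \<le> r' 20" using I E by (auto simp: I_def)
    have s1: "x < NO \<Longrightarrow> h1 x = h' x" for x
      using i pi layout off by (simp add: h1_def)
    have fr1: "frame (r 20) h h1"
      using fr i pi by (auto simp: h1_def frame_def)
    have c1: "copied (r 20) h1 (r' 20) k" if "k < i" for k
      by (rule copied_update[of k i "r 20" h' "r' 20"]) (use that i I E in \<open>auto simp: I_def h1_def\<close>)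
    have at: "h1 (NO + (off + p i)) = inp (aN + i)" "h1 (QE + 2 * (off + i)) = off + p (cq i)"
      "h1 (MT + 2 * (off + p i)) = inp (aM + 2 * i)" "h1 (MT + 2 * (off + p i) + 1) = r' 20"
      using i pi layout off by (simp_all add: h1_def)
    define Q where "Q = wp copy_row (C * (11 + 3) + 1) (\<lambda>r h. I (Suc i) (r(3 := 0)) h)"
    have row: "Q r2 h2"
      if r2: "saved r r2" "r2 16 = V" "r2 4 = 1" "r2 20 = r' 20"
        "r2 31 = inp (aM + 2 * i)" "r2 32 = inp (aM + 2 * i + 1)"
        "r2 21 = n - Suc i" "r2 22 = aQ + 1 + 2 * Suc i" "r2 25 = aM + 2 * Suc i" "r2 26 = aN + Suc i"
        "r2 27 = QE + 2 * (off + Suc i)" "r2 28 = V + Suc i" and h2: "h2 = h1" for r2 h2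
      unfolding Q_def h2
    proof (rule wp_mono[OF wp_copy_row[where i = i]])
      show "r2 16 = V" "r2 4 = 1" "i < n" "r2 31 = inp (aM + 2 * i)" "r2 32 = inp (aM + 2 * i + 1)"
        using r2 i by simp_all
      show "\<forall>k<n. h1 (V + k) = off + p k" using s1 lowV layout by simp
      show "\<forall>x<F. h1 x = inp x" using s1 lowF layout by simp
      show "V + n \<le> r2 20" using r2(4) le(2) layout by simp
    next
      fix r3 h3
      assume *: "saved r2 r3 \<and> (\<forall>x \<in> {21..28}. x \<noteq> 24 \<longrightarrow> r3 x = r2 x) \<and>
        r3 20 = r2 20 + 2 * inp (aM + 2 * i) \<and> (\<forall>x < r2 20. h3 x = h1 x) \<and>
        (\<forall>t < inp (aM + 2 * i). h3 (r2 20 + 2 * t) = off + p (inp (inp (aM + 2 * i + 1) + 2 * t)) \<and>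
          h3 (r2 20 + 2 * t + 1) = inp (inp (aM + 2 * i + 1) + 2 * t + 1))"
      have agree: "\<forall>x<r' 20. h3 x = h1 x" using * r2(4) by simp
      have e3: "r3 20 = r' 20 + 2 * inp (aM + 2 * i)" using * r2(4) by simp
      have "frame (r 20) h h3" using fr1 agree le(1) by (simp add: frame_def)
      moreover have "copied (r 20) h3 (r3 20) k" if "k < i" for k
        using copied_extend[OF _ c1[OF that] E le(1) _ agree] that i e3 by simp
      moreover have "copied (r 20) h3 (r3 20) i"
      proof -
        have "NO + (off + p i) < r' 20" "QE + 2 * (off + i) < r' 20" "MT + 2 * (off + p i) + 1 < r' 20"
          using pi i le(2) layout off by simp_all
        then have "h3 (NO + (off + p i)) = inp (aN + i)" "h3 (QE + 2 * (off + i)) = off + p (cq i)"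
            "h3 (MT + 2 * (off + p i)) = inp (aM + 2 * i)" "h3 (MT + 2 * (off + p i) + 1) = r' 20"
          using agree at by auto
        then show ?thesis using * r2(4) le(1) by (simp add: copied_def)
      qed
      ultimately have "\<forall>k<Suc i. copied (r 20) h3 (r3 20) k" by (auto simp: less_Suc_eq)
      moreover have "saved r (r3(3 := 0))" using * r2(1) saved_trans saved_upd by blast
      ultimately show "I (Suc i) (r3(3 := 0)) h3"
        using * r2 e3 le(1) \<open>frame (r 20) h h3\<close> unfolding I_def by simp
    qed simp
    \<comment> \<open>The program doubles by adding a register to itself.\<close>
    have double: "off + p i + (off + p i) + MT = MT + 2 * (off + p i)" by simp
    have upd: "h'(QE + (2 * off + 2 * i) := off + p (cq i), NO + (off + p i) := inp (aN + i),
        off + p i + (off + p i) + MT := inp (aM + 2 * i), Suc (off + p i + (off + p i) + MT) := r' 20) = h1"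
      unfolding h1_def double by simp
    have reg: "r' 21 = n - i" "r' 22 = Suc (aQ + 2 * i)" "r' 25 = aM + 2 * i" "r' 26 = aN + i"
        "r' 27 = QE + 2 * (off + i)" "r' 28 = V + i" and sv: "saved r r'"
      using I by (simp_all add: I_def)
    have lv: "h' (V + i) = off + p i" using lowV i by simp
    have "wp ?b 25 Q r' h'"
    proof (rule wp_Block)
      fix b
      let ?s = "fold exec (case ?b of Block xs \<Rightarrow> xs) \<lparr>pc = b, reg = r', mem = h'\<rparr>"
      have "Q (reg ?s) (mem ?s)"
        by (rule row) (simp_all add: reg sv saved_upd l1 l2 l3 l4 lv pr upd)
      then show "Q (reg (fold exec [Load 24 22, Load 24 24, Add 24 24 16, Load 24 24, Load 29 28, Load 33 26,
        Add 30 18 29, Add 29 29 29, Add 29 29 19, Add 34 29 4, Load 31 25, Add 25 25 4, Load 32 25,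
        Store 27 24, Store 30 33, Store 29 31, Store 34 20,
        Add 25 25 4, Add 22 22 4, Add 22 22 4, Add 26 26 4, Add 27 27 4, Add 27 27 4,
        Add 28 28 4, Sub 21 21 4] \<lparr>pc = b, reg = r', mem = h'\<rparr>))
        (mem (fold exec [Load 24 22, Load 24 24, Add 24 24 16, Load 24 24, Load 29 28, Load 33 26,
        Add 30 18 29, Add 29 29 29, Add 29 29 19, Add 34 29 4, Load 31 25, Add 25 25 4, Load 32 25,
        Store 27 24, Store 30 33, Store 29 31, Store 34 20,
        Add 25 25 4, Add 22 22 4, Add 22 22 4, Add 26 26 4, Add 27 27 4, Add 27 27 4,
        Add 28 28 4, Sub 21 21 4] \<lparr>pc = b, reg = r', mem = h'\<rparr>))" by (simp only: com.case)
    qed simp_all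
    then have "wp (Seq ?b copy_row) (25 + (C * (11 + 3) + 1)) (\<lambda>r h. I (Suc i) (r(3 := 0)) h) r' h'"
      unfolding Q_def by (rule wp_Seq)
    then show ?thesis using reg(1) i by simp
  qed
  have exit: "I n r' h' \<Longrightarrow> r' 21 = 0" for r' h' by (simp add: I_def)
  define Q where "Q = wp (While 21 (Seq ?b copy_row)) (n * ((25 + (C * (11 + 3) + 1)) + 3) + 1)
    (\<lambda>r' h'. saved r r' \<and> r 20 \<le> r' 20 \<and> frame (r 20) h h' \<and> (\<forall>k<n. copied (r 20) h' (r' 20) k))"
  have loop: "Q r' h'" if "saved r r'" "r' 21 = n" "r' 22 = aQ + 1" "r' 25 = aM" "r' 26 = aN"
    "r' 27 = QE + 2 * off" "r' 28 = V" "r' 20 = r 20" "h' = h" for r' h'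
    unfolding Q_def
  proof (rule wp_mono)
    show "wp (While 21 (Seq ?b copy_row)) (n * ((25 + (C * (11 + 3) + 1)) + 3) + 1) (I n) r' h'"
      by (rule wp_While, erule (1) body, erule exit) (use that in \<open>simp add: I_def frame_def\<close>)
  qed (auto simp: I_def)
  show ?thesis
    unfolding copy_har_def
  proof (rule wp_Seq, fold Q_def, rule wp_Block)
    fix b
    show "Q (reg (fold exec [Const 3 0, Add 21 10 3, Add 22 12 4, Add 25 13 3, Add 26 14 3,
        Add 27 15 15, Add 27 27 17, Add 28 16 3] \<lparr>pc = b, reg = r, mem = h\<rparr>))
      (mem (fold exec [Const 3 0, Add 21 10 3, Add 22 12 4, Add 25 13 3, Add 26 14 3,
        Add 27 15 15, Add 27 27 17, Add 28 16 3] \<lparr>pc = b, reg = r, mem = h\<rparr>))"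
      using r unfolding params_def by (intro loop) (simp_all add: saved_upd saved_refl)
  qed simp_all
qed

end

section \<open>Sparse storage and gluing\<close>

definition row_set :: "nat mat \<Rightarrow> nat \<Rightarrow> (nat \<times> nat) set"
  where "row_set A i = {(j, A $$ (i, j)) | j. j < dim_col A \<and> A $$ (i, j) \<noteq> 0}"

text \<open>Row \<open>i\<close> lists the edges into vertex \<open>i\<close>. This transfers what
  is known about incoming edges under reordering and gluing to stored rows.\<close>

lemma row_set_in_edges:
  assumes "i < dim_row A"
  shows "row_set A i = (\<lambda>e. (fst e, edge_label A e)) ` in_edges A i"
  using assms by (auto simp: row_set_def in_edges_def edges_def edge_label_def image_iff)

lemma card_row_set: "i < dim_row A \<Longrightarrow> card (row_set A i) \<le> card (in_edges A i)"
  unfolding row_set_in_edges in_edges_def using finite_edges by (intro card_image_le) simp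

lemma row_set_perm_mat:
  assumes "p permutes {..<K}" "k < K"
  shows "row_set (perm_mat K p) (p k) = {(k, 1)}"
  using assms perm_lt[OF assms(1), of k] permutes_inj[OF assms(1)]
  by (auto simp: row_set_def perm_mat_def inj_eq split: if_splits)

lemma mat_atD:
  assumes "mat_at h free a A" "i < dim_row A"
  defines "es \<equiv> row_entries h (h (a + 2 * i + 1)) (h (a + 2 * i))"
  shows "distinct es" "set es = row_set A i" "h (a + 2 * i) = card (row_set A i)"
    "h (a + 2 * i + 1) + 2 * h (a + 2 * i) \<le> free" "a + 2 * dim_row A \<le> free"
proof -
  show 1: "distinct es" "set es = row_set A i"
    using assms by (auto simp: mat_at_def Let_def row_set_def)
  have "length es = h (a + 2 * i)" by (simp add: es_def row_entries_def)
  then show "h (a + 2 * i) = card (row_set A i)" using 1 distinct_card by metis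
qed (use assms in \<open>auto simp: mat_at_def Let_def\<close>)

lemma mat_atI:
  assumes "a + 2 * dim_row A \<le> free"
    and "\<And>i. i < dim_row A \<Longrightarrow> h (a + 2 * i + 1) + 2 * h (a + 2 * i) \<le> free"
    and "\<And>i. i < dim_row A \<Longrightarrow> distinct (row_entries h (h (a + 2 * i + 1)) (h (a + 2 * i)))"
    and "\<And>i. i < dim_row A \<Longrightarrow> set (row_entries h (h (a + 2 * i + 1)) (h (a + 2 * i))) = row_set A i"
  shows "mat_at h free a A"
  using assms unfolding mat_at_def Let_def row_set_def by blast

lemma row_entry_in:
  assumes "t < d"
  shows "(h (q + 2 * t), h (q + 2 * t + 1)) \<in> set (row_entries h q d)"
  using assms by (auto simp: row_entries_def)

text \<open>Row \<open>p k\<close> has a single non-zero entry, in column \<open>k\<close>, so its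
  list has length one and its first cell can be read without any search.\<close>

lemma mat_at_perm:
  assumes "mat_at h free a (perm_mat K p)" "p permutes {..<K}" "k < K"
  shows "h (a + 2 * p k + 1) < free" "h (h (a + 2 * p k + 1)) = k"
proof -
  have pk: "p k < dim_row (perm_mat K p)" using assms perm_lt by simp
  note D = mat_atD[OF assms(1) pk]
  have d: "h (a + 2 * p k) = 1" using D(3) row_set_perm_mat[OF assms(2,3)] by simp
  then show "h (a + 2 * p k + 1) < free" using D(4) by simp
  show "h (h (a + 2 * p k + 1)) = k"
    using row_entry_in[of 0 1 h "h (a + 2 * p k + 1)"] D(2) row_set_perm_mat[OF assms(2,3)] d by simp
qed

lemma mat_at_permI:
  assumes p: "p permutes {..<K}" and "a + 2 * K \<le> free"
    and h: "\<And>i. i < K \<Longrightarrow> h (a + 2 * i) = 1 \<and> h (a + 2 * i + 1) = b + 2 * i \<and>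
      h (b + 2 * i) < K \<and> p (h (b + 2 * i)) = i \<and> h (b + 2 * i + 1) = 1"
    and "b + 2 * K \<le> free"
  shows "mat_at h free a (perm_mat K p)"
proof (rule mat_atI)
  fix i assume "i < dim_row (perm_mat K p)"
  then have i: "i < K" by simp
  have e: "row_entries h (h (a + 2 * i + 1)) (h (a + 2 * i)) = [(h (b + 2 * i), 1)]"
    using h[OF i] by (simp add: row_entries_def)
  show "distinct (row_entries h (h (a + 2 * i + 1)) (h (a + 2 * i)))" unfolding e by simp
  show "set (row_entries h (h (a + 2 * i + 1)) (h (a + 2 * i))) = row_set (perm_mat K p) i"
    unfolding e using row_set_perm_mat[OF p, of "h (b + 2 * i)"] h[OF i] by simp
  show "h (a + 2 * i + 1) + 2 * h (a + 2 * i) \<le> free" using h[OF i] i assms(4) by simp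
qed (use assms in simp)

text \<open>Rows hold incoming edges, which is why arities alone, without coarities, bound their
  length.\<close>

lemma card_in_edges_le:
  assumes f: "labelled_hypergraph \<Sigma> K M N" and k: "k < K"
    and C: "1 \<le> C" "\<And>g. g \<in> ops \<Sigma> \<Longrightarrow> arity \<Sigma> g \<le> C"
  shows "card (in_edges M k) \<le> C"
proof (cases "N ! k")
  case Bullet
  then have "card (in_edges M k) \<le> 1" using f k unfolding labelled_hypergraph_def by blast
  then show ?thesis using C(1) by simp
next
  case (Circ g)
  then have "bij_betw (edge_label M) (in_edges M k) {1..arity \<Sigma> g}"
    using f k unfolding labelled_hypergraph_def by blast
  then have "card (in_edges M k) = arity \<Sigma> g" using bij_betw_same_card by fastforce
  moreover have "Circ g \<in> set N" using f k Circ unfolding labelled_hypergraph_def by (metis nth_mem)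
  then have "g \<in> ops \<Sigma>" using f unfolding labelled_hypergraph_def by auto
  ultimately show ?thesis using C(2) by simp
qed

text \<open>The rows of \<open>Q\<close> are read in order, so the column found in row
  \<open>k\<close> is the value of the inverse of \<open>q\<close> at \<open>k\<close>; this is
  where \<open>cq\<close> comes from.\<close>

lemma copying_passI:
  assumes f: "labelled_hypergraph \<Sigma> n M N"
    and C: "1 \<le> C" "\<And>g. g \<in> ops \<Sigma> \<Longrightarrow> arity \<Sigma> g \<le> C"
    and p: "p permutes {..<n}" and q: "q permutes {..<n}"
    and M: "mat_at inp F aM M" and N: "labels_at code inp F aN N"
    and P: "mat_at inp F aP (perm_mat n p)" and Q: "mat_at inp F aQ (perm_mat n q)"
    and layout: "off + n \<le> S" "F \<le> V" "V + n \<le> NO" "NO + S \<le> MT" "MT + 2 * S \<le> QE"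
  shows "copying_pass inp F n S C aP aQ aM aN off V NO MT QE p (inv_into UNIV q)"
proof -
  have c: "M \<in> carrier_mat n n" "length N = n" using f by (auto simp: labelled_hypergraph_def)
  have "inp (aQ + 2 * k + 1) < F \<and> inp (inp (aQ + 2 * k + 1)) = inv_into UNIV q k \<and> inv_into UNIV q k < n"
    if "k < n" for k
    using mat_at_perm[OF Q q, of "inv_into UNIV q k"] that perm_lt[OF permutes_inv[OF q], of k]
    by (simp add: permutes_inverses[OF q])
  moreover have "inp (aM + 2 * k) \<le> C \<and> inp (aM + 2 * k + 1) + 2 * inp (aM + 2 * k) \<le> F" if "k < n" for k
    using mat_atD(3,4)[OF M, of k] that c card_row_set[of k M] card_in_edges_le[OF f that C] by simp
  moreover have "inp (inp (aM + 2 * k + 1) + 2 * t) < n" if "k < n" "t < inp (aM + 2 * k)" for k t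
  proof -
    have "(inp (inp (aM + 2 * k + 1) + 2 * t), inp (inp (aM + 2 * k + 1) + 2 * t + 1)) \<in> row_set M k"
      using row_entry_in[OF that(2), of inp "inp (aM + 2 * k + 1)"] mat_atD(2)[OF M, of k] that c by simp
    then show ?thesis using c by (auto simp: row_set_def)
  qed
  moreover have "aP + 2 * n \<le> F" "aQ + 2 * n \<le> F" "aM + 2 * n \<le> F" "aN + n \<le> F"
    using M N P Q c by (simp_all add: mat_at_def labels_at_def)
  ultimately show ?thesis
    using mat_at_perm[OF P p] layout p unfolding copying_pass_def by blast
qed

section \<open>Rows under reordering and gluing\<close>

lemma row_set_reordered:
  fixes N N' :: "'o node_label list"
  assumes re: "reordered K p M N M' N'" and k: "k < K"
  shows "row_set M' (p k) = (\<lambda>(j, v). (p j, v)) ` row_set M k"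
proof -
  have d: "k < dim_row M" "p k < dim_row M'"
    using re k perm_lt[OF re_p[OF re]] by (auto simp: reordered_def)
  have "(\<lambda>e. (fst e, edge_label M' e)) ` map_prod p p ` in_edges M k
      = (\<lambda>(j, v). (p j, v)) ` (\<lambda>e. (fst e, edge_label M e)) ` in_edges M k"
    unfolding image_image
    by (rule image_cong) (auto simp: re_label[OF re] in_edges_def)
  then show ?thesis unfolding row_set_in_edges[OF d(1)] row_set_in_edges[OF d(2)] re_in[OF re] .
qed

context
  fixes K K' m and A B and NA NB :: "'o node_label list" and \<Sigma>
  assumes A: "labelled_hypergraph \<Sigma> K A NA" and B: "labelled_hypergraph \<Sigma> K' B NB"
    and RA: "right_interface A NA = {K - m..<K}" and LB: "left_interface B NB = {..<m}"
    and mK: "m \<le> K"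
begin

lemmas ctx = A B RA LB mK

text \<open>This covers the \<open>m\<close> shared rows too: a shared node takes its incoming edges
  from the left factor and its outgoing edges from the right one.\<close>

lemma row_set_glue_left:
  assumes "i < K"
  shows "row_set (glue_mat K K' m A B) i = row_set A i"
proof -
  have d: "i < dim_row A" "i < dim_row (glue_mat K K' m A B)"
    using glue_carrier[OF ctx] glue_carr[OF ctx] glue_mK'[OF ctx] assms by auto
  show ?thesis unfolding row_set_in_edges[OF d(1)] row_set_in_edges[OF d(2)] glue_in_A[OF ctx assms]
    by (rule image_cong) (auto simp: glue_label_A[OF ctx] in_edges_def)
qed

text \<open>From \<open>m\<close> on, row \<open>i\<close> of \<open>B\<close> lands at
  \<open>K\<close> or beyond, past all rows of \<open>A\<close>. Rows and columns are shifted by the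
  same \<open>K - m\<close>.\<close>

lemma row_set_glue_right:
  assumes "m \<le> i" "i < K'"
  shows "row_set (glue_mat K K' m A B) (K - m + i) = (\<lambda>(j, v). (K - m + j, v)) ` row_set B i"
proof -
  have d: "i < dim_row B" "i + (K - m) < dim_row (glue_mat K K' m A B)"
    using glue_carrier[OF ctx] glue_carr[OF ctx] mK assms by auto
  have "(\<lambda>e. (fst e, edge_label (glue_mat K K' m A B) e)) `
      map_prod (\<lambda>x. x + (K - m)) (\<lambda>x. x + (K - m)) ` in_edges B i
      = (\<lambda>(j, v). (j + (K - m), v)) ` (\<lambda>e. (fst e, edge_label B e)) ` in_edges B i"
    unfolding image_image
    by (rule image_cong) (auto simp: glue_label_B[OF ctx] in_edges_def)
  then show ?thesis
    unfolding add.commute[of "K - m"] row_set_in_edges[OF d(1)] row_set_in_edges[OF d(2)]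
      glue_in_B[OF ctx assms(1)] .
qed

end

section \<open>The composition program\<close>

definition merge_har :: com
  where "merge_har = Seq invert_perm copy_har"

context copying_pass
begin

text \<open>Compared with \<open>frame\<close>, the work table at \<open>V\<close> is exempt as
  well, because inversion fills it first. Per vertex, inversion takes 11 steps and copying 29
  besides the entries, together bounded by 41; each entry takes 14.\<close>

lemma wp_merge_har:
  assumes r: "params r" and h: "\<forall>x<F. h x = inp x" and E: "QE + 2 * S \<le> r 20"
  shows "wp merge_har (C * (n * 14) + 41 * n + 14)
    (\<lambda>r' h'. saved r r' \<and> r 20 \<le> r' 20 \<and>
      (\<forall>x<r 20. x \<notin> {V..<V + n} \<longrightarrow> x \<notin> {NO + off..<NO + off + n} \<longrightarrow>
        x \<notin> {MT + 2 * off..<MT + 2 * off + 2 * n} \<longrightarrow> (\<forall>k<n. x \<noteq> QE + 2 * (off + k)) \<longrightarrow> h' x = h x) \<and>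
      (\<forall>k<n. copied (r 20) h' (r' 20) k)) r h" (is "wp _ _ ?Q _ _")
proof -
  have "wp merge_har (4 + (n * (8 + 3) + 1) + (8 + (n * ((25 + (C * (11 + 3) + 1)) + 3) + 1))) ?Q r h"
    unfolding merge_har_def
  proof (rule wp_Seq, rule wp_mono[OF wp_invert_perm[OF r h]])
    fix r' h'
    assume *: "saved r r' \<and> r' 20 = r 20 \<and>
      (\<forall>x. x < V \<or> V + n \<le> x \<longrightarrow> h' x = h x) \<and> (\<forall>k<n. h' (V + k) = off + p k)"
    show "wp copy_har (8 + (n * ((25 + (C * (11 + 3) + 1)) + 3) + 1)) ?Q r' h'"
    proof (rule wp_mono[OF wp_copy_har[of r' h']])
      show "params r'" using * r saved_params by blast
      show "\<forall>x<F. h' x = inp x" using * h layout(1) by simp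
      show "QE + 2 * S \<le> r' 20" "\<forall>k<n. h' (V + k) = off + p k" using * E by simp_all
    next
      fix r'' h''
      assume **: "saved r' r'' \<and> r' 20 \<le> r'' 20 \<and> frame (r' 20) h' h'' \<and>
        (\<forall>k<n. copied (r' 20) h'' (r'' 20) k)"
      have "saved r r''" using * ** saved_trans by blast
      then show "?Q r'' h''" using * ** by (auto simp: frame_def)
    qed simp
  qed simp
  then show ?thesis by (rule wp_mono) (simp_all add: algebra_simps)
qed

end

section \<open>Identity tables for the two boundary orders\<close>

definition id_rows :: "nat \<Rightarrow> nat \<Rightarrow> com"
  where "id_rows a b = Seq (Block [Const 3 0, Add 21 44 3, Add 22 a 3, Add 24 b 3, Const 26 0])
    (While 21 (Block [Store 22 4, Add 22 22 4, Store 22 24, Add 22 22 4, Store 24 26, Add 24 24 4,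
      Store 24 4, Add 24 24 4, Add 26 26 4, Sub 21 21 4]))"

text \<open>The column map \<open>c\<close> is a parameter, so that the same format describes the
  initial identity tables and the finished boundary orders.\<close>

definition perm_rows_at :: "(nat \<Rightarrow> nat) \<Rightarrow> nat \<Rightarrow> nat \<Rightarrow> (nat \<Rightarrow> nat) \<Rightarrow> bool"
  where "perm_rows_at h T S c \<longleftrightarrow> (\<forall>i<S. h (T + 2 * i) = 1 \<and> h (T + 2 * i + 1) = T + 2 * S + 2 * i \<and>
    h (T + 2 * S + 2 * i) = c i \<and> h (T + 2 * S + 2 * i + 1) = 1)"

text \<open>Only the column cells of rows in \<open>X\<close> may change. With \<open>X\<close>
  empty this says that a table survives a phase.\<close>

lemma perm_rows_at_update:
  assumes "perm_rows_at h T S c"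
    and "\<And>x. T \<le> x \<Longrightarrow> x < T + 4 * S \<Longrightarrow> (\<And>i. i \<in> X \<Longrightarrow> x \<noteq> T + 2 * S + 2 * i) \<Longrightarrow> h' x = h x"
    and "\<And>i. i \<in> X \<Longrightarrow> h' (T + 2 * S + 2 * i) = c' i" "\<And>i. i < S \<Longrightarrow> i \<notin> X \<Longrightarrow> c' i = c i"
    and X: "X \<subseteq> {..<S}"
  shows "perm_rows_at h' T S c'"
  unfolding perm_rows_at_def
proof (intro allI impI conjI)
  fix i assume i: "i < S"
  have o: "h (T + 2 * i) = 1" "h (T + 2 * i + 1) = T + 2 * S + 2 * i"
    "h (T + 2 * S + 2 * i) = c i" "h (T + 2 * S + 2 * i + 1) = 1"
    using assms(1) i by (simp_all add: perm_rows_at_def)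
  show "h' (T + 2 * i) = 1" by (subst assms(2)) (use i o in simp_all)
  show "h' (T + 2 * i + 1) = T + 2 * S + 2 * i" by (subst assms(2)) (use i o in simp_all)
  \<comment> \<open>Value cells have odd offset from the start of the entries, so no column cell
    coincides with one.\<close>
  have "T + 2 * S + 2 * i + 1 \<noteq> T + 2 * S + 2 * j" for j by presburger
  then show "h' (T + 2 * S + 2 * i + 1) = 1" using i o(4) assms(2)[of "T + 2 * S + 2 * i + 1"] by simp
  show "h' (T + 2 * S + 2 * i) = c' i"
  proof (cases "i \<in> X")
    case False
    then have "h' (T + 2 * S + 2 * i) = h (T + 2 * S + 2 * i)" using i by (intro assms(2)) auto
    then show ?thesis using assms(4)[OF i False] o(3) by simp
  qed (rule assms(3))
qed

lemma wp_id_rows: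
  assumes r: "r 4 = 1" "r 44 = S" "r a = T" "r b = T + 2 * S" "40 \<le> a" "40 \<le> b"
  shows "wp (id_rows a b) (13 * S + 6) (\<lambda>r' h'. (\<forall>x. x < 3 \<or> 4 \<le> x \<and> x \<le> 20 \<or> 40 \<le> x \<longrightarrow> r' x = r x) \<and>
    (\<forall>x. x < T \<or> T + 4 * S \<le> x \<longrightarrow> h' x = h x) \<and> perm_rows_at h' T S (\<lambda>i. i)) r h"
proof -
  let ?E = "T + 2 * S"
  define rows_upto where "rows_upto = (\<lambda>h' n. \<forall>i<n. h' (T + 2 * i) = 1 \<and> h' (T + 2 * i + 1) = ?E + 2 * i \<and>
    h' (?E + 2 * i) = i \<and> h' (?E + 2 * i + 1) = 1)"
  define I where "I = (\<lambda>i r' h'. (\<forall>x. x < 3 \<or> 4 \<le> x \<and> x \<le> 20 \<or> 40 \<le> x \<longrightarrow> r' x = r x) \<and>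
    r' 21 = S - i \<and> r' 22 = T + 2 * i \<and> r' 24 = ?E + 2 * i \<and> r' 26 = i \<and>
    (\<forall>x. x < T \<or> T + 4 * S \<le> x \<longrightarrow> h' x = h x) \<and> rows_upto h' i)"
  let ?b = "Block [Store 22 4, Add 22 22 4, Store 22 24, Add 22 22 4, Store 24 26, Add 24 24 4,
      Store 24 4, Add 24 24 4, Add 26 26 4, Sub 21 21 4]"
  have body: "r' 21 \<noteq> 0 \<and> wp ?b 10 (\<lambda>r h. I (Suc i) (r(3 := 0)) h) r' h'"
    if i: "i < S" and I: "I i r' h'" for i r' h'
  proof -
    have sv: "\<And>x. x < 3 \<or> 4 \<le> x \<and> x \<le> 20 \<or> 40 \<le> x \<Longrightarrow> r' x = r x"
      and reg: "r' 21 = S - i" "r' 22 = T + 2 * i" "r' 24 = ?E + 2 * i" "r' 26 = i"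
      and fr: "\<forall>x. x < T \<or> T + 4 * S \<le> x \<longrightarrow> h' x = h x" and rows: "rows_upto h' i"
      using I by (auto simp: I_def)
    have r4: "r' 4 = 1" using sv r(1) by simp
    define h2 where "h2 = h'(T + 2 * i := 1, Suc (T + 2 * i) := ?E + 2 * i, ?E + 2 * i := i,
      Suc (?E + 2 * i) := 1)"
    have "h2 (T + 2 * k) = 1 \<and> h2 (T + 2 * k + 1) = ?E + 2 * k \<and> h2 (?E + 2 * k) = k \<and>
        h2 (?E + 2 * k + 1) = 1" if k: "k < Suc i" for k
    proof (cases "k = i")
      case True
      have "T + 2 * i + 1 < ?E + 2 * i" using i by simp
      then show ?thesis unfolding True h2_def by simp
    next
      case False
      then have "T + 2 * k + 1 < T + 2 * i" "T + 2 * k + 1 < ?E" "?E + 2 * k + 1 < ?E + 2 * i"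
        "T + 2 * i + 1 < ?E + 2 * k"
        using k i by simp_all
      then have "h2 (T + 2 * k) = h' (T + 2 * k)" "h2 (T + 2 * k + 1) = h' (T + 2 * k + 1)"
        "h2 (?E + 2 * k) = h' (?E + 2 * k)" "h2 (?E + 2 * k + 1) = h' (?E + 2 * k + 1)"
        by (simp_all add: h2_def)
      then show ?thesis using rows k False by (simp add: rows_upto_def)
    qed
    then have rows2: "rows_upto h2 (Suc i)" by (simp add: rows_upto_def)
    have fr2: "\<forall>x. x < T \<or> T + 4 * S \<le> x \<longrightarrow> h2 x = h x"
    proof (intro allI impI)
      fix x assume x: "x < T \<or> T + 4 * S \<le> x"
      then have "x < T + 2 * i \<or> ?E + 2 * i + 1 < x" using i by auto
      then have "h2 x = h' x" by (auto simp: h2_def)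
      then show "h2 x = h x" using fr x by simp
    qed
    have step: "I (Suc i) r2 h3" if "\<forall>x. x < 3 \<or> 4 \<le> x \<and> x \<le> 20 \<or> 40 \<le> x \<longrightarrow> r2 x = r' x"
      "r2 21 = S - Suc i" "r2 22 = T + 2 * Suc i" "r2 24 = ?E + 2 * Suc i" "r2 26 = Suc i" "h3 = h2"
      for r2 h3
    proof -
      have "\<forall>x. x < 3 \<or> 4 \<le> x \<and> x \<le> 20 \<or> 40 \<le> x \<longrightarrow> r2 x = r x" using that(1) sv by simp
      then show ?thesis unfolding I_def that(6) using that(2-5) fr2 rows2 by (intro conjI)
    qed
    have "wp ?b 10 (\<lambda>r h. I (Suc i) (r(3 := 0)) h) r' h'"
      by (rule wp_Block; (rule step)?) (simp_all add: reg r4 h2_def)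
    then show ?thesis using reg(1) i by simp
  qed
  have exit: "I S r' h' \<Longrightarrow> r' 21 = 0" for r' h' by (simp add: I_def)
  define Q where "Q = wp (While 21 ?b) (S * (10 + 3) + 1)
    (\<lambda>r' h'. (\<forall>x. x < 3 \<or> 4 \<le> x \<and> x \<le> 20 \<or> 40 \<le> x \<longrightarrow> r' x = r x) \<and>
    (\<forall>x. x < T \<or> T + 4 * S \<le> x \<longrightarrow> h' x = h x) \<and> perm_rows_at h' T S (\<lambda>i. i))"
  have loop: "Q r' h'" if "\<forall>x. x < 3 \<or> 4 \<le> x \<and> x \<le> 20 \<or> 40 \<le> x \<longrightarrow> r' x = r x" "r' 21 = S" "r' 22 = T"
    "r' 24 = ?E" "r' 26 = 0" "h' = h" for r' h'
    unfolding Q_def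
  proof (rule wp_mono)
    show "wp (While 21 ?b) (S * (10 + 3) + 1) (I S) r' h'"
      by (rule wp_While, erule (1) body, erule exit) (use that in \<open>simp add: I_def rows_upto_def\<close>)
  qed (auto simp: I_def rows_upto_def perm_rows_at_def)
  have "wp (id_rows a b) (5 + (S * (10 + 3) + 1))
    (\<lambda>r' h'. (\<forall>x. x < 3 \<or> 4 \<le> x \<and> x \<le> 20 \<or> 40 \<le> x \<longrightarrow> r' x = r x) \<and>
    (\<forall>x. x < T \<or> T + 4 * S \<le> x \<longrightarrow> h' x = h x) \<and> perm_rows_at h' T S (\<lambda>i. i)) r h"
    unfolding id_rows_def
  proof (rule wp_Seq, fold Q_def, rule wp_Block)
    fix b'
    show "Q (reg (fold exec [Const 3 0, Add 21 44 3, Add 22 a 3, Add 24 b 3, Const 26 0]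
        \<lparr>pc = b', reg = r, mem = h\<rparr>))
      (mem (fold exec [Const 3 0, Add 21 44 3, Add 22 a 3, Add 24 b 3, Const 26 0]
        \<lparr>pc = b', reg = r, mem = h\<rparr>))"
      using r by (intro loop) simp_all
  qed simp_all
  then show ?thesis by (rule wp_mono) (simp_all add: algebra_simps)
qed

section \<open>The phases of the program\<close>

definition load_inputs :: com
  where "load_inputs = Block [Const 4 1, Const 3 0,
    Add 20 0 3, Load 58 20, Add 20 20 4, Load 42 20, Add 20 20 4, Load 40 20, Add 20 20 4, Load 50 20,
    Add 20 20 4, Load 51 20, Add 20 20 4, Load 52 20, Add 20 20 4, Load 53 20,
    Add 20 1 4, Load 59 20, Add 20 20 4, Load 41 20, Add 20 20 4, Load 54 20,
    Add 20 20 4, Load 55 20, Add 20 20 4, Load 56 20, Add 20 20 4, Load 57 20,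
    Sub 43 40 42, Add 44 43 41, Add 16 2 3, Add 18 2 40, Add 18 18 41, Add 19 18 44, Add 21 44 44,
    Add 45 19 21, Add 46 45 21, Add 47 46 21, Add 48 47 21, Add 49 48 21, Const 21 7, Add 20 49 21]"

text \<open>Gluing uses \<open>g\<close> in its left order, so \<open>g_L\<close> renumbers its
  vertices and \<open>g_R\<close> is the order to be rewritten. For \<open>f\<close> the two roles
  are exchanged.\<close>

definition pass_right :: com
  where "pass_right = Block [Const 3 0, Add 10 41 3, Add 11 55 3, Add 12 56 3, Add 13 54 3, Add 14 57 3,
    Add 15 43 3, Add 17 48 3]"

definition pass_left :: com
  where "pass_left = Block [Const 3 0, Add 10 40 3, Add 11 52 3, Add 12 51 3, Add 13 50 3, Add 14 53 3,
    Const 15 0, Add 17 46 3]"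

definition store_result :: com
  where "store_result = Block [Const 3 0, Add 21 49 3, Store 21 58, Add 21 21 4, Store 21 59,
    Add 21 21 4, Store 21 44, Add 21 21 4, Store 21 19, Add 21 21 4, Store 21 45,
    Add 21 21 4, Store 21 47, Add 21 21 4, Store 21 18, Add 0 49 3, Add 2 20 3]"

definition compose_hars :: com
  where "compose_hars = Seq load_inputs (Seq (id_rows 45 46) (Seq (id_rows 47 48)
    (Seq pass_right (Seq merge_har (Seq pass_left (Seq merge_har store_result))))))"

definition row_copied ::
    "(nat \<Rightarrow> nat) \<Rightarrow> nat \<Rightarrow> nat \<Rightarrow> (nat \<Rightarrow> nat) \<Rightarrow> nat \<Rightarrow> (nat \<Rightarrow> nat) \<Rightarrow> nat \<Rightarrow> nat \<Rightarrow> bool"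
  where "row_copied inp aM off p MT h e k \<longleftrightarrow>
    h (MT + 2 * (off + p k)) = inp (aM + 2 * k) \<and>
    h (MT + 2 * (off + p k) + 1) + 2 * inp (aM + 2 * k) \<le> e \<and>
    row_entries h (h (MT + 2 * (off + p k) + 1)) (inp (aM + 2 * k)) =
      map (\<lambda>(j, v). (off + p j, v)) (row_entries inp (inp (aM + 2 * k + 1)) (inp (aM + 2 * k)))"

lemma (in copying_pass) copied_row_copied:
  assumes "copied E h e k"
    and "h' (MT + 2 * (off + p k)) = h (MT + 2 * (off + p k))"
    and "h' (MT + 2 * (off + p k) + 1) = h (MT + 2 * (off + p k) + 1)"
    and "\<And>x. E \<le> x \<Longrightarrow> x < e \<Longrightarrow> h' x = h x"
    and "e \<le> e'"
  shows "row_copied inp aM off p MT h' e' k"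
  using assms unfolding row_copied_def copied_def row_entries_def by auto

text \<open>
  From the free address \<open>F\<close> on, the program lays out a work array of length \<open>K + K'\<close>, the label array \<open>NO\<close>,
  the row table \<open>MT\<close>, the row tables \<open>LT\<close>, \<open>RT\<close> of the boundary orders, each followed by its entries
  (\<open>LE\<close>, \<open>RE\<close>), the header \<open>H\<close>, and finally the entries of the rows of \<open>MT\<close>.
\<close>

locale composition =
  left: copying_pass inp F K S C fR fL fM fN 0 F NO MT LE rf cf +
  right: copying_pass inp F K' S C gL gR gM gN d F NO MT RE lg cg
  for inp and F K K' S C fL fR fM fN gL gR gM gN d NO MT LE RE and rf cf lg cg :: "nat \<Rightarrow> nat" +
  fixes f g n m l LT RT H :: nat
  assumes sizes: "d = K - m" "S = d + K'" "NO = F + K + K'" "MT = NO + S" "LT = MT + 2 * S"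
      "LE = LT + 2 * S" "RT = LE + 2 * S" "RE = RT + 2 * S" "H = RE + 2 * S" "K \<le> S"
    and f: "inp f = n" "inp (f + 1) = m" "inp (f + 2) = K" "inp (f + 3) = fM" "inp (f + 4) = fL"
      "inp (f + 5) = fR" "inp (f + 6) = fN"
    and g: "inp (g + 1) = l" "inp (g + 2) = K'" "inp (g + 3) = gM" "inp (g + 4) = gL"
      "inp (g + 5) = gR" "inp (g + 6) = gN"
begin

definition globals :: "(nat \<Rightarrow> nat) \<Rightarrow> bool"
  where "globals r \<longleftrightarrow> r 4 = 1 \<and> r 16 = F \<and> r 18 = NO \<and> r 19 = MT \<and> r 40 = K \<and> r 41 = K' \<and> r 42 = m \<and>
    r 43 = d \<and> r 44 = S \<and> r 45 = LT \<and> r 46 = LE \<and> r 47 = RT \<and> r 48 = RE \<and> r 49 = H \<and>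
    r 50 = fM \<and> r 51 = fL \<and> r 52 = fR \<and> r 53 = fN \<and> r 54 = gM \<and> r 55 = gL \<and> r 56 = gR \<and> r 57 = gN \<and>
    r 58 = n \<and> r 59 = l"

lemma globals_cong:
  assumes "globals r" "\<forall>x. 4 \<le> x \<and> x < 20 \<or> 40 \<le> x \<longrightarrow> r' x = r x"
  shows "globals r'"
  using assms by (simp add: globals_def)

lemma wp_load_inputs:
  assumes "r 0 = f" "r 1 = g" "r 2 = F"
  shows "wp load_inputs 42 (\<lambda>r' h'. globals r' \<and> r' 20 = H + 7 \<and> h' = inp) r inp"
proof -
  have f': "inp f = n" "inp (Suc f) = m" "inp (Suc (Suc f)) = K" "inp (Suc (Suc (Suc f))) = fM"
      "inp (Suc (Suc (Suc (Suc f)))) = fL" "inp (Suc (Suc (Suc (Suc (Suc f))))) = fR"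
      "inp (Suc (Suc (Suc (Suc (Suc (Suc f)))))) = fN"
    using f by (simp_all add: eval_nat_numeral)
  have g': "inp (Suc g) = l" "inp (Suc (Suc g)) = K'" "inp (Suc (Suc (Suc g))) = gM"
      "inp (Suc (Suc (Suc (Suc g)))) = gL" "inp (Suc (Suc (Suc (Suc (Suc g))))) = gR"
      "inp (Suc (Suc (Suc (Suc (Suc (Suc g)))))) = gN"
    using g by (simp_all add: eval_nat_numeral)
  have sums: "MT + (S + S) = LT" "LT + (S + S) = LE" "LE + (S + S) = RT" "RT + (S + S) = RE"
      "RE + (S + S) = H"
    using sizes by simp_all
  show ?thesis
    unfolding load_inputs_def globals_def
    by (intro wp_Block)
      (simp_all add: assms assms(2)[unfolded One_nat_def] f' g' sizes(1-4)[symmetric] sums)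
qed

lemma wp_pass_right:
  assumes "globals r"
  shows "wp pass_right 8 (\<lambda>r' h'. globals r' \<and> right.params r' \<and> r' 20 = r 20 \<and> h' = h) r h"
  unfolding pass_right_def
  using assms by (intro wp_Block) (simp_all add: globals_def right.params_def)

lemma wp_pass_left:
  assumes "globals r"
  shows "wp pass_left 8 (\<lambda>r' h'. globals r' \<and> left.params r' \<and> r' 20 = r 20 \<and> h' = h) r h"
  unfolding pass_left_def
  using assms by (intro wp_Block) (simp_all add: globals_def left.params_def)

lemma wp_store_result:
  assumes "globals r"
  shows "wp store_result 17 (\<lambda>r' h'. r' 0 = H \<and> r' 2 = r 20 \<and>
    (\<forall>x. x < H \<or> H + 7 \<le> x \<longrightarrow> h' x = h x) \<and> h' H = n \<and> h' (H + 1) = l \<and> h' (H + 2) = S \<and>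
    h' (H + 3) = MT \<and> h' (H + 4) = LT \<and> h' (H + 5) = RT \<and> h' (H + 6) = NO) r h"
  unfolding store_result_def
  using assms by (intro wp_Block) (simp_all add: globals_def)

end

context composition
begin

text \<open>With \<open>cf\<close> the inverse of \<open>lf\<close>, this is the inverse of
  \<open>lf \<circ> inv_into UNIV rf\<close>, continued by the identity from \<open>K\<close>
  on.\<close>

definition left_col :: "nat \<Rightarrow> nat" where "left_col i = (if i < K then rf (cf i) else i)"

definition right_col :: "nat \<Rightarrow> nat" where "right_col i = (if i < d then i else d + lg (cg (i - d)))"

definition right_merged :: "(nat \<Rightarrow> nat) \<Rightarrow> nat \<Rightarrow> bool"
  where "right_merged h e \<longleftrightarrow> (\<forall>x<F. h x = inp x) \<and> H + 7 \<le> e \<and> perm_rows_at h LT S (\<lambda>i. i) \<and>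
    perm_rows_at h RT S right_col \<and> (\<forall>k<K'. right.copied (H + 7) h e k)"

text \<open>Positions from \<open>d\<close> up to \<open>K\<close> are shared and end up with the
  data of \<open>f\<close>; data of \<open>g\<close> is therefore claimed only from position
  \<open>K\<close> on.\<close>

definition merged :: "(nat \<Rightarrow> nat) \<Rightarrow> nat \<Rightarrow> bool"
  where "merged h e \<longleftrightarrow> H + 7 \<le> e \<and> perm_rows_at h LT S left_col \<and> perm_rows_at h RT S right_col \<and>
    (\<forall>k<K. h (NO + rf k) = inp (fN + k) \<and> row_copied inp fM 0 rf MT h e k) \<and>
    (\<forall>k<K'. K \<le> d + lg k \<longrightarrow> h (NO + (d + lg k)) = inp (gN + k) \<and> row_copied inp gM d lg MT h e k)"

lemma right_mergedI:
  assumes inp: "\<forall>x<F. h x = inp x" and LT: "perm_rows_at h LT S (\<lambda>i. i)"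
    and RT: "perm_rows_at h RT S (\<lambda>i. i)" and e: "H + 7 \<le> e"
    and frame: "\<forall>x<H + 7. x \<notin> {F..<F + K'} \<longrightarrow> x \<notin> {NO + d..<NO + d + K'} \<longrightarrow>
        x \<notin> {MT + 2 * d..<MT + 2 * d + 2 * K'} \<longrightarrow> (\<forall>k<K'. x \<noteq> RE + 2 * (d + k)) \<longrightarrow> h' x = h x"
    and copied: "\<forall>k<K'. right.copied (H + 7) h' e k"
  shows "right_merged h' e"
proof -
  have "h' x = inp x" if "x < F" for x
  proof -
    have "h' x = h x" by (rule frame[rule_format]) (use that sizes in auto)
    then show ?thesis using inp that by simp
  qed
  moreover have "perm_rows_at h' LT S (\<lambda>i. i)"
  proof (rule perm_rows_at_update[OF LT, where X = "{}"])
    fix x assume "LT \<le> x" "x < LT + 4 * S"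
    then show "h' x = h x" using sizes by (intro frame[rule_format]) auto
  qed auto
  moreover have "perm_rows_at h' RT S right_col"
  proof (rule perm_rows_at_update[OF RT, where X = "{d..<S}"])
    fix x assume x: "RT \<le> x" "x < RT + 4 * S" "\<And>i. i \<in> {d..<S} \<Longrightarrow> x \<noteq> RT + 2 * S + 2 * i"
    have "x \<noteq> RE + 2 * (d + k)" if "k < K'" for k using x(3)[of "d + k"] that sizes by simp
    then show "h' x = h x" using x(1,2) sizes by (intro frame[rule_format]) auto
  next
    fix i assume "i \<in> {d..<S}"
    then have "i = d + (i - d)" "i - d < K'" using sizes(2) by auto
    then have "h' (RE + 2 * i) = d + lg (cg (i - d))"
      using copied right.copied_def by metis
    then show "h' (RT + 2 * S + 2 * i) = right_col i"
      using \<open>i \<in> {d..<S}\<close> sizes(8) by (simp add: right_col_def)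
  qed (auto simp: right_col_def)
  ultimately show ?thesis using e copied by (simp add: right_merged_def)
qed

text \<open>\<open>h\<close>, \<open>h'\<close> and \<open>h''\<close> are the memories after the
  right pass, after the left pass and after the header is stored. The row lists of \<open>g\<close>
  lie between \<open>H + 7\<close> and \<open>e\<close>, where the left pass allocates nothing. The
  literal zeros are the offset of the left pass.\<close>

lemma mergedI:
  assumes right: "right_merged h e" and e: "e \<le> e'"
    and frame: "\<forall>x<e. x \<notin> {F..<F + K} \<longrightarrow> x \<notin> {NO + 0..<NO + 0 + K} \<longrightarrow>
        x \<notin> {MT + 2 * 0..<MT + 2 * 0 + 2 * K} \<longrightarrow> (\<forall>k<K. x \<noteq> LE + 2 * (0 + k)) \<longrightarrow> h' x = h x"
    and copied: "\<forall>k<K. left.copied e h' e' k"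
    and agree: "\<forall>x. x < H \<or> H + 7 \<le> x \<longrightarrow> h'' x = h' x"
  shows "merged h'' e'"
proof -
  have e0: "H + 7 \<le> e" using right by (simp add: right_merged_def)
  have frame': "h'' x = h x"
    if "x < e" "F + K \<le> x" "x < NO \<or> NO + K \<le> x" "x < MT \<or> MT + 2 * K \<le> x"
      "x < LE \<or> LE + 2 * K \<le> x" "x < H \<or> H + 7 \<le> x" for x
  proof -
    have "h' x = h x" by (rule frame[rule_format]) (use that in auto)
    moreover have "h'' x = h' x" using agree that(6) by blast
    ultimately show ?thesis by simp
  qed
  have "perm_rows_at h'' RT S right_col"
  proof (rule perm_rows_at_update[where X = "{}"])
    fix x assume "RT \<le> x" "x < RT + 4 * S"
    then show "h'' x = h x" using sizes e0 by (intro frame') auto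
  qed (use right in \<open>auto simp: right_merged_def\<close>)
  moreover have "perm_rows_at h'' LT S left_col"
  proof (rule perm_rows_at_update[where X = "{..<K}"])
    show "perm_rows_at h LT S (\<lambda>i. i)" using right by (simp add: right_merged_def)
  next
    fix x assume x: "LT \<le> x" "x < LT + 4 * S" "\<And>i. i \<in> {..<K} \<Longrightarrow> x \<noteq> LT + 2 * S + 2 * i"
    have "x \<noteq> LE + 2 * (0 + k)" if "k < K" for k using x(3)[of k] that sizes by simp
    then have "h' x = h x" using x(1,2) sizes e0 by (intro frame[rule_format]) auto
    then show "h'' x = h x" using agree x(2) sizes by simp
  next
    fix i assume i: "i \<in> {..<K}"
    then have "h' (LE + 2 * (0 + i)) = 0 + rf (cf i)"
      using copied left.copied_def by (metis lessThan_iff)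
    moreover have "LE + 2 * i < H" using i sizes by simp
    ultimately show "h'' (LT + 2 * S + 2 * i) = left_col i"
      using i sizes(6) agree by (simp add: left_col_def)
  qed (use sizes(10) in \<open>auto simp: left_col_def\<close>)
  moreover have "h'' (NO + rf k) = inp (fN + k) \<and> row_copied inp fM 0 rf MT h'' e' k" if "k < K" for k
  proof -
    have c: "left.copied e h' e' k" using copied that by blast
    then have *: "h' (NO + (0 + rf k)) = inp (fN + k)" using left.copied_def by blast
    have "rf k < S" using perm_lt[OF left.p] that sizes(10) by (meson less_le_trans)
    then have "NO + rf k < H" "MT + 2 * (0 + rf k) + 1 < H" using sizes(4-9) by simp_all
    then show ?thesis
      using left.copied_row_copied[OF c, of h'' e'] * agree e0 by simp
  qed
  moreover have "h'' (NO + (d + lg k)) = inp (gN + k) \<and> row_copied inp gM d lg MT h'' e' k"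
    if k: "k < K'" "K \<le> d + lg k" for k
  proof -
    have c: "right.copied (H + 7) h e k" using right k(1) by (simp add: right_merged_def)
    have b: "d + lg k < S" using perm_lt[OF right.p] k(1) sizes(2) by simp
    then have lt: "NO + (d + lg k) < MT" "MT + 2 * (d + lg k) + 1 < LT" using sizes(4,5) by simp_all
    have ge: "F + K \<le> NO" "NO \<le> MT" "MT \<le> LT" "LT \<le> LE" "LE + 2 * K \<le> H" "LE \<le> H"
      "NO + K \<le> MT" "MT + 2 * K \<le> H"
      using sizes(3-10) by - (linarith+)
    have "h'' (NO + (d + lg k)) = h (NO + (d + lg k))"
      using k(2) ge lt e0 by (intro frame') linarith+
    moreover have "h (NO + (d + lg k)) = inp (gN + k)" using c right.copied_def by blast
    moreover have "row_copied inp gM d lg MT h'' e' k"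
    proof (rule right.copied_row_copied[OF c _ _ _ e])
      have "h'' (MT + 2 * w) = h (MT + 2 * w) \<and> h'' (MT + 2 * w + 1) = h (MT + 2 * w + 1)"
        if "K \<le> w" "MT + 2 * w + 1 < LT" for w
        using that ge e0 by (intro conjI frame') linarith+
      then show "h'' (MT + 2 * (d + lg k)) = h (MT + 2 * (d + lg k))"
        "h'' (MT + 2 * (d + lg k) + 1) = h (MT + 2 * (d + lg k) + 1)"
        using k(2) lt(2) by blast+
      show "h'' x = h x" if "H + 7 \<le> x" "x < e" for x using that ge by (intro frame') linarith+
    qed
    ultimately show ?thesis by simp
  qed
  ultimately show ?thesis using e0 e by (simp add: merged_def)
qed

lemma wp_compose_hars:
  assumes r: "r 0 = f" "r 1 = g" "r 2 = F" and h: "h = inp"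
  shows "wp compose_hars ((14 * C + 67) * (K + K') + 115) (\<lambda>r' h'. r' 0 = H \<and> merged h' (r' 2) \<and>
    h' H = n \<and> h' (H + 1) = l \<and> h' (H + 2) = S \<and> h' (H + 3) = MT \<and> h' (H + 4) = LT \<and>
    h' (H + 5) = RT \<and> h' (H + 6) = NO) r h" (is "wp _ _ ?Q _ _")
proof -
  have "wp compose_hars (42 + ((13 * S + 6) + ((13 * S + 6) + (8 + ((C * (K' * 14) + 41 * K' + 14) +
      (8 + ((C * (K * 14) + 41 * K + 14) + 17))))))) ?Q r h"
    unfolding compose_hars_def h
  proof (rule wp_Seq, rule wp_mono[OF wp_load_inputs[OF r]])
    fix r1 h1 assume 1: "globals r1 \<and> r1 20 = H + 7 \<and> h1 = inp"
    show "wp (Seq (id_rows 45 46) (Seq (id_rows 47 48) (Seq pass_right (Seq merge_har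
        (Seq pass_left (Seq merge_har store_result))))))
      ((13 * S + 6) + ((13 * S + 6) + (8 + ((C * (K' * 14) + 41 * K' + 14) +
      (8 + ((C * (K * 14) + 41 * K + 14) + 17)))))) ?Q r1 h1"
    proof (rule wp_Seq, rule wp_mono[OF wp_id_rows[where S = S and T = LT]])
      fix r2 h2 assume 2: "(\<forall>x. x < 3 \<or> 4 \<le> x \<and> x \<le> 20 \<or> 40 \<le> x \<longrightarrow> r2 x = r1 x) \<and>
        (\<forall>x. x < LT \<or> LT + 4 * S \<le> x \<longrightarrow> h2 x = h1 x) \<and> perm_rows_at h2 LT S (\<lambda>i. i)"
      then have "\<forall>x. 4 \<le> x \<and> x < 20 \<or> 40 \<le> x \<longrightarrow> r2 x = r1 x" by auto
      then have g2: "globals r2" "r2 20 = H + 7" using globals_cong[of r1 r2] 1 2 by simp_all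
      show "wp (Seq (id_rows 47 48) (Seq pass_right (Seq merge_har
          (Seq pass_left (Seq merge_har store_result)))))
        ((13 * S + 6) + (8 + ((C * (K' * 14) + 41 * K' + 14) +
        (8 + ((C * (K * 14) + 41 * K + 14) + 17))))) ?Q r2 h2"
      proof (rule wp_Seq, rule wp_mono[OF wp_id_rows[where S = S and T = RT]])
        fix r3 h3 assume 3: "(\<forall>x. x < 3 \<or> 4 \<le> x \<and> x \<le> 20 \<or> 40 \<le> x \<longrightarrow> r3 x = r2 x) \<and>
          (\<forall>x. x < RT \<or> RT + 4 * S \<le> x \<longrightarrow> h3 x = h2 x) \<and> perm_rows_at h3 RT S (\<lambda>i. i)"
        then have "\<forall>x. 4 \<le> x \<and> x < 20 \<or> 40 \<le> x \<longrightarrow> r3 x = r2 x" by auto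
        then have g3: "globals r3" "r3 20 = H + 7" using globals_cong[of r2 r3] g2 3 by simp_all
        have i3: "\<forall>x<F. h3 x = inp x" using 1 2 3 sizes by simp
        have l3: "perm_rows_at h3 LT S (\<lambda>i. i)"
        proof (rule perm_rows_at_update[where X = "{}"])
          show "perm_rows_at h2 LT S (\<lambda>i. i)" using 2 by blast
          show "h3 x = h2 x" if "x < LT + 4 * S" for x using that 3 sizes by simp
        qed auto
        show "wp (Seq pass_right (Seq merge_har (Seq pass_left (Seq merge_har store_result))))
          (8 + ((C * (K' * 14) + 41 * K' + 14) + (8 + ((C * (K * 14) + 41 * K + 14) + 17)))) ?Q r3 h3"
        proof (rule wp_Seq, rule wp_mono[OF wp_pass_right[OF g3(1)]])
          fix r4 h4 assume 4: "globals r4 \<and> right.params r4 \<and> r4 20 = r3 20 \<and> h4 = h3"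
          then have p4: "right.params r4" "\<forall>x<F. h4 x = inp x" "RE + 2 * S \<le> r4 20" and e4: "r4 20 = H + 7"
            using i3 g3 sizes(9) by simp_all
          show "wp (Seq merge_har (Seq pass_left (Seq merge_har store_result)))
            ((C * (K' * 14) + 41 * K' + 14) + (8 + ((C * (K * 14) + 41 * K + 14) + 17))) ?Q r4 h4"
          proof (rule wp_Seq, rule wp_mono[OF right.wp_merge_har[OF p4]], unfold e4)
            fix r5 h5 assume 5: "saved r4 r5 \<and> H + 7 \<le> r5 20 \<and>
              (\<forall>x<H + 7. x \<notin> {F..<F + K'} \<longrightarrow> x \<notin> {NO + d..<NO + d + K'} \<longrightarrow>
                x \<notin> {MT + 2 * d..<MT + 2 * d + 2 * K'} \<longrightarrow> (\<forall>k<K'. x \<noteq> RE + 2 * (d + k)) \<longrightarrow> h5 x = h4 x) \<and>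
              (\<forall>k<K'. right.copied (H + 7) h5 (r5 20) k)"
            have "\<forall>x. 4 \<le> x \<and> x < 20 \<or> 40 \<le> x \<longrightarrow> r5 x = r4 x" using 5 by (auto simp: saved_def)
            then have g5: "globals r5" using globals_cong[of r4 r5] 4 by blast
            have m5: "right_merged h5 (r5 20)"
              using right_mergedI[OF i3 l3, of "r5 20" h5] 3 4 5 by blast
            show "wp (Seq pass_left (Seq merge_har store_result))
              (8 + ((C * (K * 14) + 41 * K + 14) + 17)) ?Q r5 h5"
            proof (rule wp_Seq, rule wp_mono[OF wp_pass_left[OF g5]])
              fix r6 h6 assume 6: "globals r6 \<and> left.params r6 \<and> r6 20 = r5 20 \<and> h6 = h5"
              have "LE + 2 * S \<le> r5 20" using 5 sizes(7-9) by linarith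
              then have p6: "left.params r6" "\<forall>x<F. h6 x = inp x" "LE + 2 * S \<le> r6 20" and e6: "r6 20 = r5 20"
                using 6 m5 by (simp_all add: right_merged_def)
              show "wp (Seq merge_har store_result) ((C * (K * 14) + 41 * K + 14) + 17) ?Q r6 h6"
              proof (rule wp_Seq, rule wp_mono[OF left.wp_merge_har[OF p6]], unfold e6)
                fix r7 h7 assume 7: "saved r6 r7 \<and> r5 20 \<le> r7 20 \<and>
                  (\<forall>x<r5 20. x \<notin> {F..<F + K} \<longrightarrow> x \<notin> {NO + 0..<NO + 0 + K} \<longrightarrow>
                    x \<notin> {MT + 2 * 0..<MT + 2 * 0 + 2 * K} \<longrightarrow> (\<forall>k<K. x \<noteq> LE + 2 * (0 + k)) \<longrightarrow> h7 x = h6 x) \<and>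
                  (\<forall>k<K. left.copied (r5 20) h7 (r7 20) k)"
                have "\<forall>x. 4 \<le> x \<and> x < 20 \<or> 40 \<le> x \<longrightarrow> r7 x = r6 x" using 7 by (auto simp: saved_def)
                then have g7: "globals r7" using globals_cong[of r6 r7] 6 by blast
                show "wp store_result 17 ?Q r7 h7"
                proof (rule wp_mono[OF wp_store_result[OF g7]])
                  fix r8 h8 :: "nat \<Rightarrow> nat" assume 8: "r8 0 = H \<and> r8 2 = r7 20 \<and>
                    (\<forall>x. x < H \<or> H + 7 \<le> x \<longrightarrow> h8 x = h7 x) \<and> h8 H = n \<and> h8 (H + 1) = l \<and>
                    h8 (H + 2) = S \<and> h8 (H + 3) = MT \<and> h8 (H + 4) = LT \<and> h8 (H + 5) = RT \<and> h8 (H + 6) = NO"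
                  have "merged h8 (r7 20)"
                    using mergedI[OF m5, of "r7 20" h7 h8] 6 7 8 by blast
                  then show "?Q r8 h8" using 8 by simp
                qed simp
              qed simp
            qed simp
          qed simp
        qed simp
      qed (use g2(1)[unfolded globals_def] sizes(8) in simp_all)
    qed (use 1[unfolded globals_def] sizes(6) in simp_all)
  qed simp
  \<comment> \<open>The factor 67 is 41 for the two passes plus twice 13 for the identity tables,
    whose \<open>S\<close> rows number at most \<open>K + K'\<close>.\<close>
  moreover have "S \<le> K + K'" using sizes(1,2) by simp
  then have "26 * S \<le> 26 * (K + K')" by simp
  ultimately show ?thesis by (elim wp_mono) (simp_all add: algebra_simps)
qed

end

section \<open>Composition in linear time\<close>

text \<open>The list format demands distinct entries; relabelling columns preserves this because
  \<open>p\<close> is injective.\<close>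

lemma row_copied_row_set:
  assumes c: "row_copied inp aM off p MT h e k" and M: "mat_at inp F aM M" and k: "k < dim_row M"
    and p: "inj p" and G: "row_set G (off + p k) = (\<lambda>(j, v). (off + p j, v)) ` row_set M k"
  defines "i \<equiv> off + p k"
  shows "h (MT + 2 * i + 1) + 2 * h (MT + 2 * i) \<le> e \<and>
    distinct (row_entries h (h (MT + 2 * i + 1)) (h (MT + 2 * i))) \<and>
    set (row_entries h (h (MT + 2 * i + 1)) (h (MT + 2 * i))) = row_set G i"
proof -
  have inj: "inj_on (\<lambda>(j, v). (off + p j, v)) X" for X :: "(nat \<times> nat) set"
    by (rule inj_onI) (auto dest: injD[OF p])
  define es where "es = row_entries inp (inp (aM + 2 * k + 1)) (inp (aM + 2 * k))"
  have es: "distinct es" "set es = row_set M k" using mat_atD(1,2)[OF M k] by (simp_all add: es_def)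
  have *: "h (MT + 2 * i) = inp (aM + 2 * k)" "h (MT + 2 * i + 1) + 2 * inp (aM + 2 * k) \<le> e"
    "row_entries h (h (MT + 2 * i + 1)) (inp (aM + 2 * k)) = map (\<lambda>(j, v). (off + p j, v)) es"
    using c unfolding row_copied_def i_def es_def by - (elim conjE, assumption)+
  have "distinct (map (\<lambda>(j, v). (off + p j, v)) es)" using es(1) inj by (simp only: distinct_map simp_thms)
  moreover have "set (map (\<lambda>(j, v). (off + p j, v)) es) = row_set G i"
    unfolding set_map es(2) i_def G ..
  ultimately show ?thesis unfolding *(1) *(3) using *(2) by (intro conjI)
qed

text \<open>Turns the boundary matrices of the composite into explicit permutations, which can be
  compared with the columns that the program writes.\<close>

lemma har_comp_eq:
  assumes M: "har_M f \<in> carrier_mat K K" "har_M g \<in> carrier_mat K' K'" and K: "har_K f = K" "har_K g = K'"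
    and lf: "lf permutes {..<K}" "har_L f = perm_mat K lf"
    and rf: "rf permutes {..<K}" "har_R f = perm_mat K rf"
    and lg: "lg permutes {..<K'}" "har_L g = perm_mat K' lg"
    and rg: "rg permutes {..<K'}" "har_R g = perm_mat K' rg"
    and ctx: "labelled_hypergraph \<Sigma> K (har_M (right_order f)) (har_N (right_order f))"
      "labelled_hypergraph \<Sigma> K' (har_M (left_order g)) (har_N (left_order g))"
      "right_interface (har_M (right_order f)) (har_N (right_order f)) = {K - m..<K}"
      "left_interface (har_M (left_order g)) (har_N (left_order g)) = {..<m}"
    and mK: "m \<le> K"
  shows "har_comp m f g = \<lparr>har_K = K - m + K',
    har_M = glue_mat K K' m (har_M (right_order f)) (har_M (left_order g)),
    har_L = perm_mat (K - m + K') (lf \<circ> inv_into UNIV rf),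
    har_R = perm_mat (K - m + K') (shift_perm (K - m) (rg \<circ> inv_into UNIV lg)),
    har_N = glue_labels m (har_N (right_order f)) (har_N (left_order g))\<rparr>"
proof -
  have mK': "m \<le> K'" using glue_mK'[OF ctx mK] .
  have L: "har_L (right_order f) = perm_mat K (lf \<circ> inv_into UNIV rf)"
    using perm_mat_comp[OF rf(1) lf(1)] by (simp add: right_order_def rf lf K)
  have R: "har_R (left_order g) = perm_mat K' (rg \<circ> inv_into UNIV lg)"
    using perm_mat_comp[OF lg(1) rg(1)] by (simp add: left_order_def lg rg K)
  have size: "K + (K' - m) = K - m + K'" "K + K' - m = K - m + K'" using mK mK' by simp_all
  have L': "perm_mat K (lf \<circ> inv_into UNIV rf) \<oplus>\<^sub>d 1\<^sub>m (K' - m) = perm_mat (K - m + K') (lf \<circ> inv_into UNIV rf)"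
    using perm_mat_sum_one[OF permutes_compose[OF permutes_inv[OF rf(1)] lf(1)], of "K' - m"]
    unfolding size(1) .
  have R': "1\<^sub>m (K - m) \<oplus>\<^sub>d perm_mat K' (rg \<circ> inv_into UNIV lg)
      = perm_mat (K - m + K') (shift_perm (K - m) (rg \<circ> inv_into UNIV lg))"
    by (rule perm_mat_one_sum[OF permutes_compose[OF permutes_inv[OF lg(1)] rg(1)]])
  show ?thesis
    unfolding har_comp_def K glue_mat_def[OF ctx mK] glue_labels_def[OF ctx mK] L R L' R' size(2) ..
qed

lemma wp_compose_hars_har_at:
  assumes f: "is_har \<Sigma> n m f" and g: "is_har \<Sigma> m l g"
    and C: "1 \<le> C" "\<And>x. x \<in> ops \<Sigma> \<Longrightarrow> arity \<Sigma> x \<le> C"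
    and fh: "har_at code h (r 2) (r 0) n m f" and gh: "har_at code h (r 2) (r 1) m l g"
  shows "wp compose_hars ((14 * C + 67) * (har_K f + har_K g) + 115)
    (\<lambda>r' h'. har_at code h' (r' 2) (r' 0) n l (har_comp m f g)) r h"
proof -
  define K K' where "K = har_K f" and "K' = har_K g"
  obtain lf rf where lf: "lf permutes {..<K}" "har_L f = perm_mat K lf"
    and rf: "rf permutes {..<K}" "har_R f = perm_mat K rf"
    using f by (auto simp: is_har_def is_perm_mat_def K_def)
  obtain lg rg where lg: "lg permutes {..<K'}" "har_L g = perm_mat K' lg"
    and rg: "rg permutes {..<K'}" "har_R g = perm_mat K' rg"
    using g by (auto simp: is_har_def is_perm_mat_def K'_def)
  have hf: "labelled_hypergraph \<Sigma> K (har_M f) (har_N f)"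
    and hg: "labelled_hypergraph \<Sigma> K' (har_M g) (har_N g)"
    using f g by (auto simp: is_har_def K_def K'_def)
  then have cf: "har_M f \<in> carrier_mat K K" "length (har_N f) = K"
    and cg: "har_M g \<in> carrier_mat K' K'" "length (har_N g) = K'"
    by (auto simp: labelled_hypergraph_def)
  define A NA where "A = har_M (right_order f)" and "NA = har_N (right_order f)"
  define B NB where "B = har_M (left_order g)" and "NB = har_N (left_order g)"
  have rA: "reordered K rf (har_M f) (har_N f) A NA"
    using reorderedI[OF rf(1) cf] by (simp add: A_def NA_def right_order_def rf)
  have rB: "reordered K' lg (har_M g) (har_N g) B NB"
    using reorderedI[OF lg(1) cg] by (simp add: B_def NB_def left_order_def lg)
  have hA: "labelled_hypergraph \<Sigma> K A NA" using re_hypergraph[OF rA hf] .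
  have hB: "labelled_hypergraph \<Sigma> K' B NB" using re_hypergraph[OF rB hg] .
  have RA: "right_interface A NA = {K - m..<K}" using f by (simp add: is_har_def A_def NA_def K_def)
  have LB: "left_interface B NB = {..<m}" using g by (simp add: is_har_def B_def NB_def)
  have "right_interface (har_M f) (har_N f) \<subseteq> {..<K}" using cf by (auto simp: right_interface_def)
  then have mK: "m \<le> K" using f card_mono[of "{..<K}"] by (fastforce simp: is_har_def)
  note ctx = hA hB RA LB mK
  have mK': "m \<le> K'" using glue_mK'[OF ctx] .
  define d S where "d = K - m" and "S = d + K'"
  have S: "S = K + K' - m" "K \<le> S" using mK mK' by (simp_all add: S_def d_def)
  define F where "F = r 2"
  define NO where "NO = F + K + K'"
  define MT where "MT = NO + S"
  define LT where "LT = MT + 2 * S"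
  define LE where "LE = LT + 2 * S"
  define RT where "RT = LE + 2 * S"
  define RE where "RE = RT + 2 * S"
  define H where "H = RE + 2 * S"
  note fh' = fh[unfolded har_at_def, folded F_def K_def, unfolded lf rf]
  note gh' = gh[unfolded har_at_def, folded F_def K'_def, unfolded lg rg]
  \<comment> \<open>The inverses of \<open>lf\<close> and \<open>rg\<close> appear because the row
    of a permutation matrix determines its column by the inverse. Both passes use the work array at
    \<open>F\<close>.\<close>
  interpret composition h F K K' S C "h (r 0 + 4)" "h (r 0 + 5)" "h (r 0 + 3)" "h (r 0 + 6)"
    "h (r 1 + 4)" "h (r 1 + 5)" "h (r 1 + 3)" "h (r 1 + 6)" d NO MT LE RE
    rf "inv_into UNIV lf" lg "inv_into UNIV rg" "r 0" "r 1" n m l LT RT H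
  proof (intro composition.intro composition_axioms.intro)
    show "copying_pass h F K S C (h (r 0 + 5)) (h (r 0 + 4)) (h (r 0 + 3)) (h (r 0 + 6)) 0 F NO MT LE rf (inv_into UNIV lf)"
    proof (rule copying_passI[OF hf C rf(1) lf(1)])
      show "mat_at h F (h (r 0 + 3)) (har_M f)" "labels_at code h F (h (r 0 + 6)) (har_N f)"
        "mat_at h F (h (r 0 + 5)) (perm_mat K rf)" "mat_at h F (h (r 0 + 4)) (perm_mat K lf)"
        using fh' by blast+
      show "0 + K \<le> S" "F \<le> F" "F + K \<le> NO" "NO + S \<le> MT" "MT + 2 * S \<le> LE"
        using S(2) by (simp_all add: NO_def MT_def LE_def LT_def)
    qed
    show "copying_pass h F K' S C (h (r 1 + 4)) (h (r 1 + 5)) (h (r 1 + 3)) (h (r 1 + 6)) d F NO MT RE lg (inv_into UNIV rg)"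
    proof (rule copying_passI[OF hg C lg(1) rg(1)])
      show "mat_at h F (h (r 1 + 3)) (har_M g)" "labels_at code h F (h (r 1 + 6)) (har_N g)"
        "mat_at h F (h (r 1 + 4)) (perm_mat K' lg)" "mat_at h F (h (r 1 + 5)) (perm_mat K' rg)"
        using gh' by blast+
      show "d + K' \<le> S" "F \<le> F" "F + K' \<le> NO" "NO + S \<le> MT" "MT + 2 * S \<le> RE"
        by (simp_all add: S_def NO_def MT_def RE_def RT_def LE_def LT_def)
    qed
  qed ((use fh' gh' in blast) | (rule d_def S_def NO_def MT_def LT_def LE_def RT_def RE_def H_def S(2) refl))+
  define q where "q = lf \<circ> inv_into UNIV rf"
  define q' where "q' = rg \<circ> inv_into UNIV lg"
  have q: "q permutes {..<K}" unfolding q_def by (intro permutes_compose permutes_inv rf lf)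
  have q': "q' permutes {..<K'}" unfolding q'_def by (intro permutes_compose permutes_inv rg lg)
  have qS: "q permutes {..<S}" using permutes_subset[OF q] S(2) by simp
  have QS: "shift_perm d q' permutes {..<S}" using shift_perm_permutes[OF q', of d] by (simp add: S_def)
  define G NG where "G = glue_mat K K' m A B" and "NG = glue_labels m NA NB"
  have cG: "G \<in> carrier_mat S S" "length NG = S"
    using glue_carrier[OF ctx] glue_labels_length[OF ctx] S(1) by (simp_all add: G_def NG_def)
  have comp: "har_comp m f g = \<lparr>har_K = S, har_M = G, har_L = perm_mat S q,
      har_R = perm_mat S (shift_perm d q'), har_N = NG\<rparr>"
    using har_comp_eq[OF cf(1) cg(1) K_def[symmetric] K'_def[symmetric] lf rf lg rg ctx[unfolded A_def NA_def B_def NB_def]]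
    by (simp add: S_def d_def q_def q'_def G_def NG_def A_def NA_def B_def NB_def)
  \<comment> \<open>For \<open>i \<ge> K\<close>, the index \<open>i - d\<close> is at least
    \<open>K - d = m\<close>, so such a vertex of \<open>g\<close> is not shared; all shared
    positions are attributed to \<open>f\<close>.\<close>
  have vertex: "(\<exists>k<K. i = rf k) \<or> (\<exists>k<K'. m \<le> lg k \<and> K \<le> d + lg k \<and> i = d + lg k)" if "i < S" for i
  proof (cases "i < K")
    case True
    then show ?thesis using re_vertex[OF rA] by blast
  next
    case False
    then have "d \<le> i" by (simp add: d_def)
    then have "i - d < K'" using that by (simp add: S_def)
    then obtain k where "k < K'" "i - d = lg k" using re_vertex[OF rB] by blast
    moreover have "i = d + (i - d)" "m \<le> i - d" using False mK by (simp_all add: d_def)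
    ultimately show ?thesis using False by auto
  qed
  have result: "har_at code h' (r' 2) (r' 0) n l (har_comp m f g)"
    if *: "r' 0 = H \<and> merged h' (r' 2) \<and>
      h' H = n \<and> h' (H + 1) = l \<and> h' (H + 2) = S \<and> h' (H + 3) = MT \<and> h' (H + 4) = LT \<and>
      h' (H + 5) = RT \<and> h' (H + 6) = NO" for r' h'
  proof -
    define e where "e = r' 2"
    have m: "H + 7 \<le> e" "perm_rows_at h' LT S left_col" "perm_rows_at h' RT S right_col"
      "\<And>k. k < K \<Longrightarrow> h' (NO + rf k) = h (h (r 0 + 6) + k) \<and> row_copied h (h (r 0 + 3)) 0 rf MT h' e k"
      "\<And>k. k < K' \<Longrightarrow> K \<le> d + lg k \<Longrightarrow> h' (NO + (d + lg k)) = h (h (r 1 + 6) + k) \<and>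
        row_copied h (h (r 1 + 3)) d lg MT h' e k"
      using * unfolding merged_def e_def by blast+
    have "h' (MT + 2 * i + 1) + 2 * h' (MT + 2 * i) \<le> e \<and>
        distinct (row_entries h' (h' (MT + 2 * i + 1)) (h' (MT + 2 * i))) \<and>
        set (row_entries h' (h' (MT + 2 * i + 1)) (h' (MT + 2 * i))) = row_set G i" if "i < S" for i
      using vertex[OF that]
    proof (elim disjE exE conjE)
      fix k assume k: "k < K" "i = rf k"
      have "row_set G (0 + rf k) = (\<lambda>(j, v). (0 + rf j, v)) ` row_set (har_M f) k"
        using row_set_glue_left[OF ctx] row_set_reordered[OF rA k(1)] perm_lt[OF rf(1)] k(1)
        by (simp add: G_def)
      from row_copied_row_set[OF _ _ _ permutes_inj[OF rf(1)] this] show ?thesis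
        using m(4)[OF k(1)] fh' cf(1) k by (metis add_0 carrier_matD(1))
    next
      fix k assume k: "k < K'" "m \<le> lg k" "K \<le> d + lg k" "i = d + lg k"
      have "lg k < K'" using perm_lt[OF lg(1)] k(1) by blast
      then have "row_set G (d + lg k) = (\<lambda>(j, v). (d + lg j, v)) ` row_set (har_M g) k"
        using row_set_glue_right[OF ctx k(2)] row_set_reordered[OF rB k(1)]
        by (simp add: G_def d_def image_image case_prod_beta)
      from row_copied_row_set[OF _ _ _ permutes_inj[OF lg(1)] this] show ?thesis
        using m(5)[OF k(1,3)] gh' cg(1) k by (metis carrier_matD(1))
    qed
    moreover have "MT + 2 * S \<le> e" using m(1) sizes by simp
    ultimately have matM: "mat_at h' e MT G" using cG by (intro mat_atI) auto
    have matL: "mat_at h' e LT (perm_mat S q)"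
    proof (rule mat_at_permI[OF qS, where b = "LT + 2 * S"])
      fix i assume i: "i < S"
      \<comment> \<open>Below \<open>K\<close> the inverses cancel in
        \<open>lf (inv_into UNIV rf (rf (inv_into UNIV lf i)))\<close>; from \<open>K\<close> on,
        \<open>q\<close> fixes \<open>i\<close>.\<close>
      have "left_col i < S \<and> q (left_col i) = i"
      proof (cases "i < K")
        case True
        then have "rf (inv_into UNIV lf i) < K"
          using perm_lt[OF rf(1)] perm_lt[OF permutes_inv[OF lf(1)]] by blast
        then show ?thesis using True S(2)
          by (simp add: left_col_def q_def permutes_inverses[OF rf(1)] permutes_inverses[OF lf(1)])
      next
        case False
        then show ?thesis using i permutes_not_in[OF q, of i] by (simp add: left_col_def)
      qed
      then show "h' (LT + 2 * i) = 1 \<and> h' (LT + 2 * i + 1) = LT + 2 * S + 2 * i \<and>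
          h' (LT + 2 * S + 2 * i) < S \<and> q (h' (LT + 2 * S + 2 * i)) = i \<and> h' (LT + 2 * S + 2 * i + 1) = 1"
        using m(2) i by (simp add: perm_rows_at_def)
    qed (use m(1) sizes in simp_all)
    have matR: "mat_at h' e RT (perm_mat S (shift_perm d q'))"
    proof (rule mat_at_permI[OF QS, where b = "RT + 2 * S"])
      fix i assume i: "i < S"
      have "right_col i < S \<and> shift_perm d q' (right_col i) = i"
      proof (cases "i < d")
        case True
        then show ?thesis using i by (simp add: right_col_def shift_perm_def)
      next
        case False
        then have "i - d < K'" using i by (simp add: S_def)
        then have "lg (inv_into UNIV rg (i - d)) < K'"
          using perm_lt[OF lg(1)] perm_lt[OF permutes_inv[OF rg(1)]] by blast
        then show ?thesis using False
          by (simp add: right_col_def q'_def S_def shift_perm_def permutes_inverses[OF lg(1)] permutes_inverses[OF rg(1)])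
      qed
      then show "h' (RT + 2 * i) = 1 \<and> h' (RT + 2 * i + 1) = RT + 2 * S + 2 * i \<and>
          h' (RT + 2 * S + 2 * i) < S \<and> shift_perm d q' (h' (RT + 2 * S + 2 * i)) = i \<and>
          h' (RT + 2 * S + 2 * i + 1) = 1"
        using m(3) i by (simp add: perm_rows_at_def)
    qed (use m(1) sizes in simp_all)
    have "h' (NO + i) = label_code code (NG ! i)" if "i < S" for i
      using vertex[OF that]
    proof (elim disjE exE conjE)
      fix k assume k: "k < K" "i = rf k"
      have "NG ! i = NA ! rf k" using glue_labels_A[OF ctx] perm_lt[OF rf(1)] k by (simp add: NG_def)
      also have "\<dots> = har_N f ! k" using rA k(1) by (simp add: reordered_def)
      finally show ?thesis using m(4)[OF k(1)] fh' cf(2) k by (simp add: labels_at_def)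
    next
      fix k assume k: "k < K'" "m \<le> lg k" "K \<le> d + lg k" "i = d + lg k"
      have "NG ! i = NB ! lg k"
        using glue_labels_B[OF ctx, of "lg k"] perm_lt[OF lg(1)] k by (simp add: NG_def d_def add.commute)
      also have "\<dots> = har_N g ! k" using rB k(1) by (simp add: reordered_def)
      finally show ?thesis using m(5)[OF k(1,3)] gh' cg(2) k by (simp add: labels_at_def)
    qed
    then have "labels_at code h' e NO NG" using cG(2) m(1) sizes by (simp add: labels_at_def)
    then show ?thesis using * m(1) matM matL matR by (simp add: har_at_def comp e_def)
  qed
  have "wp compose_hars ((14 * C + 67) * (K + K') + 115)
    (\<lambda>r' h'. har_at code h' (r' 2) (r' 0) n l (har_comp m f g)) r h"
    by (rule wp_mono[OF wp_compose_hars]) (rule refl F_def[symmetric] le_refl | erule result)+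
  then show ?thesis by (simp add: K_def K'_def)
qed

theorem proposition6p4:
  fixes \<Sigma> :: "'o signature"
  assumes "finite (ops \<Sigma>)"
  shows "\<exists>T :: nat \<Rightarrow> nat.
    (\<lambda>k. real (T k)) \<in> O(\<lambda>k. real k) \<and>
    (\<forall>code :: 'o \<Rightarrow> nat. inj_on code (ops \<Sigma>) \<longrightarrow>
      (\<exists>prog :: instr list. \<forall>n m l f g s.
         is_har \<Sigma> n m f \<longrightarrow>
         is_har \<Sigma> m l g \<longrightarrow>
         pc s = 0 \<longrightarrow>
         har_at code (mem s) (reg s 2) (reg s 0) n m f \<longrightarrow>
         har_at code (mem s) (reg s 2) (reg s 1) m l g \<longrightarrow>
         (\<exists>s'. halts_within prog (T (har_K f + har_K g)) s s' \<and>
               har_at code (mem s') (reg s' 2) (reg s' 0) n l (har_comp m f g))))"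
proof -
  \<comment> \<open>The 1 accounts for the incoming edge of a bullet vertex and keeps the maximum
    defined for an empty signature.\<close>
  define C where "C = Max (insert 1 (arity \<Sigma> ` ops \<Sigma>))"
  have C: "1 \<le> C" "arity \<Sigma> x \<le> C" if "x \<in> ops \<Sigma>" for x
    using assms that by (auto simp: C_def intro: Max_ge)
  have C1: "1 \<le> C" using assms by (auto simp: C_def intro: Max_ge)
  \<comment> \<open>For \<open>k \<ge> 1\<close> the additive 115 is absorbed into the factor,
    giving 67 + 115 = 182.\<close>
  have "(\<lambda>k. real ((14 * C + 67) * k + 115)) \<in> O(\<lambda>k. real k)"
  proof (rule bigoI)
    show "\<forall>\<^sub>F k in at_top. norm (real ((14 * C + 67) * k + 115)) \<le> (14 * real C + 182) * norm (real k)"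
      using eventually_ge_at_top[of 1]
    proof eventually_elim
      case (elim k)
      then have "(14 * C + 67) * k + 115 \<le> (14 * C + 182) * k" by (simp add: algebra_simps)
      then have "real ((14 * C + 67) * k + 115) \<le> real ((14 * C + 182) * k)" by (simp only: of_nat_le_iff)
      then show ?case by simp
    qed
  qed
  moreover have "\<exists>prog :: instr list. \<forall>n m l f g s.
         is_har \<Sigma> n m f \<longrightarrow>
         is_har \<Sigma> m l g \<longrightarrow>
         pc s = 0 \<longrightarrow>
         har_at code (mem s) (reg s 2) (reg s 0) n m f \<longrightarrow>
         har_at code (mem s) (reg s 2) (reg s 1) m l g \<longrightarrow>
         (\<exists>s'. halts_within prog ((14 * C + 67) * (har_K f + har_K g) + 115) s s' \<and>
               har_at code (mem s') (reg s' 2) (reg s' 0) n l (har_comp m f g))" for code :: "'o \<Rightarrow> nat"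
    by (intro exI[of _ "compile 0 compose_hars"] allI impI)
      (rule wp_halts_within[OF wp_compose_hars_har_at[OF _ _ C1 C(2)]])
  ultimately show ?thesis by (intro exI[of _ "\<lambda>k. (14 * C + 67) * k + 115"]) blast
qed

end
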